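(* Under the Setup and the Unconditional asymptotic regime described in the context, for $i,j\in\{0,1\}$, $$\lim_{p\to\infty}E_{\boldsymbol\mu,S_n}[\hat\varepsilon_i^B\hat\varepsilon_j^B]=\Phi\!\left((-1)^i\frac{-H_i+c}{\sqrt F}\right)\Phi\!\left((-1)^j\frac{-H_j+c}{\sqrt F}\right),$$ and consequently $$\lim_{p\to\infty}E_{\boldsymbol\mu,S_n}[(\hat\varepsilon^B)^2]=\left[\alpha_0\Phi\!\left(\frac{-H_0+c}{\sqrt F}\right)+\alpha_1\Phi\!\left(\frac{H_1-c}{\sqrt F}\right)\right]^2,$$ where $H_0=\frac12\big(\bar\Delta^2_{\mathbf m}+J_1-J_0+\frac{J_0}{\gamma_0}+\frac{J_1}{\gamma_1}\big)$, $H_1=-\frac12\big(\bar\Delta^2_{\mathbf m}+J_0-J_1+\frac{J_0}{\gamma_0}+\frac{J_1}{\gamma_1}\big)$, and $F=\bar\Delta^2_{\mathbf m}+J_0+J_1+\frac{J_0}{\gamma_0}+\frac{J_1}{\gamma_1}$.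
   Context: Setup. Fix $\alpha_0\in(0,1)$, $\alpha_1=1-\alpha_0$, and $c=\log\frac{1-\alpha_0}{\alpha_0}$. $\Phi$ is the standard normal CDF. For each dimension $p$ there is a known symmetric positive definite $p\times p$ matrix $\Sigma$, sample sizes $n_0,n_1$, prior means $\mathbf m_0,\mathbf m_1\in\mathbb R^p$ and prior certainty parameters $\nu_0,\nu_1>0$ (all depending on $p$; the index $p$ is suppressed). The class means are random: $\boldsymbol\mu_i\sim N(\mathbf m_i,\Sigma/\nu_i)$, $i=0,1$, independent; $\boldsymbol\mu=(\boldsymbol\mu_0,\boldsymbol\mu_1)$. Given $\boldsymbol\mu$, class $i$ has distribution $\Pi_i=N(\boldsymbol\mu_i,\Sigma)$, and the sample $S_n$ consists of $n_0$ i.i.d. points from $\Pi_0$ and, independently, $n_1$ i.i.d. points from $\Pi_1$; $\bar{\mathbf x}_0,\bar{\mathbf x}_1$ are the class sample means. The LDA classifier assigns $\mathbf x$ to class 1 if $W(\mathbf x)\le c$ and to class 0 otherwise, where $W(\mathbf x)=(\mathbf x-\frac{\bar{\mathbf x}_0+\bar{\mathbf x}_1}{2})^T\Sigma^{-1}(\bar{\mathbf x}_0-\bar{\mathbf x}_1)$. Let $\hat\delta^2=(\bar{\mathbf x}_0-\bar{\mathbf x}_1)^T\Sigma^{-1}(\bar{\mathbf x}_0-\bar{\mathbf x}_1)$. The true error is $\varepsilon=\alpha_0\varepsilon_0+\alpha_1\varepsilon_1$ with $\varepsilon_i=\Phi\Big(\frac{(-1)^{i+1}(\boldsymbol\mu_i-\frac{\bar{\mathbf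 x}_0+\bar{\mathbf x}_1}{2})^T\Sigma^{-1}(\bar{\mathbf x}_0-\bar{\mathbf x}_1)+(-1)^i c}{\hat\delta}\Big)$. The Bayesian MMSE error estimator is $\hat\varepsilon^B=\alpha_0\hat\varepsilon^B_0+\alpha_1\hat\varepsilon^B_1$ with $\hat\varepsilon_i^B=\Phi\Big((-1)^i\frac{-(\mathbf m_i^*-\frac{\bar{\mathbf x}_0+\bar{\mathbf x}_1}{2})^T\Sigma^{-1}(\bar{\mathbf x}_0-\bar{\mathbf x}_1)+c}{\hat\delta}\sqrt{\frac{\nu_i^*}{\nu_i^*+1}}\Big)$, where $\mathbf m_i^*=\frac{n_i\bar{\mathbf x}_i+\nu_i\mathbf m_i}{n_i+\nu_i}$ and $\nu_i^*=n_i+\nu_i$. Notation: $\Delta^2_{\mathbf m}=(\mathbf m_0-\mathbf m_1)^T\Sigma^{-1}(\mathbf m_0-\mathbf m_1)$, and $\bar\Delta^2_{\mathbf m}$ its limit as $p\to\infty$. Unconditional asymptotic regime. Expectations $E_{\boldsymbol\mu,S_n}$ are over both $\boldsymbol\mu$ and the sample. As $p\to\infty$: $n_0,n_1,\nu_0,\nu_1\to\infty$, $p/n_i\to J_i\in[0,\infty)$, $\nu_i/n_i\to\gamma_i\in(0,\infty)$, and for all $i,j\in\{0,1\}$, $\mathbf m_i^T\Sigma^{-1}\mathbf m_j$ converges to a finite limit. It is assumed that $F>0$ (with $F$ as in the claim). $\lim_{p\to\infty}$ denotes the limit along this regime. *)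

theory Defs
  imports "HOL-Probability.Probability"
begin

definition Phi :: "real \<Rightarrow> real" where
  "Phi x = measure (density lborel std_normal_density) {..x}"

text \<open>Vectors in R^p are functions nat => real (only indices < p matter);
  p x p matrices are functions nat => nat => real (only indices < p matter).\<close>

definition mmul :: "nat \<Rightarrow> (nat \<Rightarrow> nat \<Rightarrow> real) \<Rightarrow> (nat \<Rightarrow> nat \<Rightarrow> real) \<Rightarrow> nat \<Rightarrow> nat \<Rightarrow> real" where
  "mmul p A B i j = (\<Sum>k<p. A i k * B k j)"

definition is_inverse :: "nat \<Rightarrow> (nat \<Rightarrow> nat \<Rightarrow> real) \<Rightarrow> (nat \<Rightarrow> nat \<Rightarrow> real) \<Rightarrow> bool" where
  "is_inverse p A B \<longleftrightarrow> (\<forall>i<p. \<forall>j<p. mmul p A B i j = (if i = j then 1 else 0)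
                                  \<and> mmul p B A i j = (if i = j then 1 else 0))"

definition minv :: "nat \<Rightarrow> (nat \<Rightarrow> nat \<Rightarrow> real) \<Rightarrow> nat \<Rightarrow> nat \<Rightarrow> real" where
  "minv p A = (SOME B. is_inverse p A B)"

definition qf :: "nat \<Rightarrow> (nat \<Rightarrow> nat \<Rightarrow> real) \<Rightarrow> (nat \<Rightarrow> real) \<Rightarrow> (nat \<Rightarrow> real) \<Rightarrow> real" where
  "qf p A x y = (\<Sum>i<p. \<Sum>j<p. x i * A i j * y j)"

definition sym_pos_def :: "nat \<Rightarrow> (nat \<Rightarrow> nat \<Rightarrow> real) \<Rightarrow> bool" where
  "sym_pos_def p A \<longleftrightarrow> (\<forall>i<p. \<forall>j<p. A i j = A j i) \<and>
     (\<forall>x. (\<exists>i<p. x i \<noteq> 0) \<longrightarrow> qf p A x x > 0)"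

definition mvnormal :: "nat \<Rightarrow> (nat \<Rightarrow> real) \<Rightarrow> (nat \<Rightarrow> nat \<Rightarrow> real) \<Rightarrow> (nat \<Rightarrow> real) measure" where
  "mvnormal p m S =
     (let g = (\<lambda>x. exp (- qf p (minv p S) (\<lambda>k. x k - m k) (\<lambda>k. x k - m k) / 2));
          Z = integral\<^sup>L (PiM {..<p} (\<lambda>_. lborel)) g
      in density (PiM {..<p} (\<lambda>_. lborel)) (\<lambda>x. ennreal (g x / Z)))"

definition scale_mat :: "real \<Rightarrow> (nat \<Rightarrow> nat \<Rightarrow> real) \<Rightarrow> nat \<Rightarrow> nat \<Rightarrow> real" where
  "scale_mat a A i j = a * A i j"

definition sample_mean :: "nat \<Rightarrow> (nat \<Rightarrow> nat \<Rightarrow> real) \<Rightarrow> nat \<Rightarrow> real" where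
  "sample_mean n X k = (\<Sum>t<n. X t k) / real n"

text \<open>Bayesian MMSE error estimator of class i (i = 0,1) for LDA, given sample means
  xb0, xb1, sample size n_i, prior mean m_i, prior certainty nu_i, threshold c.\<close>
definition bayes_err_i :: "nat \<Rightarrow> (nat \<Rightarrow> nat \<Rightarrow> real) \<Rightarrow> real \<Rightarrow> nat \<Rightarrow> nat \<Rightarrow> real \<Rightarrow>
    (nat \<Rightarrow> real) \<Rightarrow> (nat \<Rightarrow> real) \<Rightarrow> (nat \<Rightarrow> real) \<Rightarrow> real" where
  "bayes_err_i p Sinv c i ni nui mi xb0 xb1 =
     (let xbi = (if i = 0 then xb0 else xb1);
          mstar = (\<lambda>k. (real ni * xbi k + nui * mi k) / (real ni + nui));
          nustar = real ni + nui;
          d = (\<lambda>k. xb0 k - xb1 k);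
          delta = sqrt (qf p Sinv d d)
      in Phi ((-1) ^ i * ((- qf p Sinv (\<lambda>k. mstar k - (xb0 k + xb1 k) / 2) d + c) / delta)
              * sqrt (nustar / (nustar + 1))))"

definition E_mu_S :: "nat \<Rightarrow> (nat \<Rightarrow> nat \<Rightarrow> real) \<Rightarrow> (nat \<Rightarrow> nat) \<Rightarrow> (nat \<Rightarrow> real) \<Rightarrow>
    (nat \<Rightarrow> nat \<Rightarrow> real) \<Rightarrow>
    ((nat \<Rightarrow> real) \<Rightarrow> (nat \<Rightarrow> real) \<Rightarrow> (nat \<Rightarrow> nat \<Rightarrow> real) \<Rightarrow> (nat \<Rightarrow> nat \<Rightarrow> real) \<Rightarrow> real) \<Rightarrow> real" where
  "E_mu_S p Sg n nu m f =
     (\<integral>mu0. (\<integral>mu1. (\<integral>X0. (\<integral>X1. f mu0 mu1 X0 X1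
          \<partial>PiM {..<n 1} (\<lambda>_. mvnormal p mu1 Sg))
        \<partial>PiM {..<n 0} (\<lambda>_. mvnormal p mu0 Sg))
      \<partial>mvnormal p (m 1) (scale_mat (1 / nu 1) Sg))
    \<partial>mvnormal p (m 0) (scale_mat (1 / nu 0) Sg))"

end

theory Submission
  imports Defs "Jordan_Normal_Form.Determinant"
begin

text \<open>Completing squares gives a matrix \<open>C\<close> with \<open>C\<^sup>T C\<close> equal to the inverse of the covariance.  In the coordinates
  \<open>C x\<close> everything is standard Gaussian, and since a sum of independent Gaussian vectors is Gaussian, the pair of
  sample means, averaged over the prior, has the law of \<open>(a\<^sub>0 + s\<^sub>0 z\<^sub>0, a\<^sub>1 + s\<^sub>1 z\<^sub>1)\<close> with independent standard
  Gaussian \<open>z\<^sub>0, z\<^sub>1\<close>, whitened prior means \<open>a\<^sub>i\<close> and \<open>s\<^sub>i\<^sup>2 = 1/\<nu>\<^sub>i + 1/n\<^sub>i\<close>.  The estimators depend only on inner products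
  of these vectors with each other and with the \<open>a\<^sub>i\<close>.  The random parts are \<open>s\<^sub>i\<^sup>2 |z\<^sub>i|\<^sup>2\<close>, which concentrates at
  \<open>lim p s\<^sub>i\<^sup>2 = J\<^sub>i + J\<^sub>i/\<gamma>\<^sub>i\<close>, and \<open>s\<^sub>i \<langle>a\<^sub>j, z\<^sub>i\<rangle>\<close> and \<open>s\<^sub>0 s\<^sub>1 \<langle>z\<^sub>0, z\<^sub>1\<rangle>\<close>, which vanish in mean square.  Hence each
  estimator tends in probability to a constant, and since it is bounded, so do the expectations of products.\<close>

section \<open>Inverses of positive definite matrices\<close>

text \<open>The expectation is an iterated integral in the order \<open>mu0\<close>,
  \<open>mu1\<close>, \<open>X0\<close>, \<open>X1\<close>, so the prior noise and the sampling
  noise of one class are separated by an integration over the other class. The order has to be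
  changed before variances can be added, and this needs measurability of every intermediate
  integral. Gaussian densities are normalized by an integral, not by a determinant; the Jacobian
  factor of \<open>C\<close> is therefore carried along as a constant \<kappa>, which cancels in the
  end. Origin of the limits: put T_i = J_i + J_i/\<gamma>_i. The squared distance of the whitened
  sample means tends to Dbar + T_0 + T_1 = F, and F > 0 keeps the division by its root continuous at
  the limit. The posterior mean gives its sample mean the weight n_i/(n_i + nu_i), with limit 1/(1 +
  \<gamma>_i), and T_i/(1 + \<gamma>_i) = J_i/\<gamma>_i; the midpoint of the sample means
  contributes (T_1 - T_0)/2. Together these give the terms of \<open>H\<close>. The correction
  factor under the root in the estimator tends to 1.\<close>

lemma is_inverse_exists:
  assumes S: "sym_pos_def p S"
  shows "\<exists>B. is_inverse p S B"
proof -
  define A where "A = mat p p (\<lambda>(i, j). S i j)"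
  have A: "A \<in> carrier_mat p p" by (simp add: A_def)
  have "det A \<noteq> 0"
  proof
    assume "det A = 0"
    \<comment> \<open>A kernel vector of a singular \<open>S\<close> makes the quadratic form
      vanish, against positive definiteness.\<close>
    then obtain v where v: "v \<in> carrier_vec p" "v \<noteq> 0\<^sub>v p" "A *\<^sub>v v = 0\<^sub>v p"
      using det_0_iff_vec_prod_zero_field[OF A] by blast
    define x where "x = vec_index v"
    have "(\<Sum>j<p. S i j * x j) = 0" if "i < p" for i
    proof -
      have "vec_index (A *\<^sub>v v) i = (\<Sum>j<p. S i j * x j)"
        using that v(1) by (simp add: A_def scalar_prod_def atLeast0LessThan x_def)
      with v(3) that show ?thesis by simp
    qed
    then have "qf p S x x = 0"
      by (simp add: qf_def mult.assoc flip: sum_distrib_left)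
    moreover have "\<exists>i<p. x i \<noteq> 0"
      using v(1,2) by (auto simp: vec_eq_iff x_def)
    ultimately show False
      using S unfolding sym_pos_def_def by fastforce
  qed
  then have "A \<in> Units (ring_mat TYPE(real) p ())"
    by (rule det_non_zero_imp_unit[OF A])
  then obtain B where B: "B \<in> carrier_mat p p" "A * B = 1\<^sub>m p" "B * A = 1\<^sub>m p"
    by (auto simp: Units_def ring_mat_def)
  have "mmul p S (\<lambda>i j. B $$ (i, j)) i j = (A * B) $$ (i, j)"
       "mmul p (\<lambda>i j. B $$ (i, j)) S i j = (B * A) $$ (i, j)" if "i < p" "j < p" for i j
    using that B(1) by (simp_all add: A_def mmul_def scalar_prod_def atLeast0LessThan)
  then have "is_inverse p S (\<lambda>i j. B $$ (i, j))"
    using B(2,3) by (simp add: is_inverse_def)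
  then show ?thesis by (rule exI[of "is_inverse p S"])
qed

lemma is_inverse_minv: "sym_pos_def p S \<Longrightarrow> is_inverse p S (minv p S)"
  unfolding minv_def using is_inverse_exists by (rule someI_ex)

lemma mmul_assoc: "mmul p (mmul p A B) C i j = mmul p A (mmul p B C) i j"
proof -
  have "mmul p (mmul p A B) C i j = (\<Sum>k<p. \<Sum>l<p. A i l * B l k * C k j)"
    by (simp add: mmul_def sum_distrib_right)
  also have "\<dots> = (\<Sum>l<p. \<Sum>k<p. A i l * B l k * C k j)"
    by (rule sum.swap)
  also have "\<dots> = mmul p A (mmul p B C) i j"
    by (simp add: mmul_def sum_distrib_left mult.assoc)
  finally show ?thesis .
qed

lemma mmul_cong:
  "(\<And>k. k < p \<Longrightarrow> A i k = A' i k) \<Longrightarrow> (\<And>k. k < p \<Longrightarrow> B k j = B' k j) \<Longrightarrow> mmul p A B i j = mmul p A' B' i j"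
  by (simp add: mmul_def)

lemma mmul_one_left: "i < p \<Longrightarrow> mmul p (\<lambda>i j. if i = j then 1 else 0) B i j = B i j"
  by (simp add: mmul_def if_distrib[of "\<lambda>x. x * _"] cong: if_cong)

lemma mmul_one_right: "j < p \<Longrightarrow> mmul p B (\<lambda>i j. if i = j then 1 else 0) i j = B i j"
  by (simp add: mmul_def if_distrib[of "\<lambda>x. _ * x"] cong: if_cong)

text \<open>A = A (S B) = (A S) B = B, entrywise on the indices below \<open>p\<close>, the only
  entries that the choice in \<open>minv\<close> pins down.\<close>

lemma is_inverse_unique:
  assumes "is_inverse p S A" "is_inverse p S B" "i < p" "j < p"
  shows "A i j = B i j"
proof -
  have "A i j = mmul p A (mmul p S B) i j"
    using assms by (subst mmul_one_right[symmetric]) (auto simp: is_inverse_def intro: mmul_cong)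
  also have "\<dots> = mmul p (mmul p A S) B i j"
    by (simp add: mmul_assoc)
  also have "\<dots> = B i j"
    using assms mmul_one_left[of i p B j]
    by (subst mmul_cong[where A' = "\<lambda>i j. if i = j then 1 else 0" and B' = B]) (auto simp: is_inverse_def)
  finally show ?thesis .
qed

text \<open>The prior covariance is the class covariance divided by \<open>nu\<close>; with this
  rule one whitening matrix serves both the prior and the samples.\<close>

lemma minv_scale_mat:
  assumes S: "sym_pos_def p S" and a: "a > 0" and ij: "i < p" "j < p"
  shows "minv p (scale_mat a S) i j = minv p S i j / a"
proof -
  have inv: "is_inverse p (scale_mat a S) (\<lambda>i j. minv p S i j / a)"
    using is_inverse_minv[OF S] a by (simp add: is_inverse_def mmul_def scale_mat_def)
  then have "is_inverse p (scale_mat a S) (minv p (scale_mat a S))"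
    unfolding minv_def[of p "scale_mat a S"] by (rule someI[where P = "is_inverse p (scale_mat a S)"])
  from is_inverse_unique[OF this inv ij] show ?thesis .
qed

lemma qf_scale_right: "qf p (\<lambda>i j. A i j / a) x y = qf p A x y / a"
  by (simp add: qf_def sum_divide_distrib)

lemma qf_cong:
  "(\<And>i j. i < p \<Longrightarrow> j < p \<Longrightarrow> A i j = B i j) \<Longrightarrow> (\<And>i. i < p \<Longrightarrow> x i = x' i) \<Longrightarrow>
    (\<And>i. i < p \<Longrightarrow> y i = y' i) \<Longrightarrow> qf p A x y = qf p B x' y'"
  by (auto simp: qf_def intro!: sum.cong)

text \<open>Symmetry: the transpose of an inverse of a symmetric matrix is again an inverse, hence
  the same one by uniqueness. Positivity: for y = V x one has x = S y and x^T V x = y^T S y, and y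
  is nonzero because x is.\<close>

lemma sym_pos_def_minv:
  assumes S: "sym_pos_def p S"
  shows "sym_pos_def p (minv p S)"
proof -
  let ?V = "minv p S"
  note inv = is_inverse_minv[OF S]
  have "mmul p S (\<lambda>i j. ?V j i) i j = mmul p ?V S j i"
    "mmul p (\<lambda>i j. ?V j i) S i j = mmul p S ?V j i" if "i < p" "j < p" for i j
    using S that by (auto simp: mmul_def sym_pos_def_def mult.commute intro!: sum.cong)
  with inv have "is_inverse p S (\<lambda>i j. ?V j i)"
    by (simp add: is_inverse_def)
  from is_inverse_unique[OF inv this] have sym: "?V i j = ?V j i" if "i < p" "j < p" for i j
    using that by blast
  moreover have "qf p ?V x x > 0" if x: "\<exists>i<p. x i \<noteq> 0" for x
  proof -
    define y where "y i = (\<Sum>j<p. ?V i j * x j)" for i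
    have Sy: "(\<Sum>j<p. S i j * y j) = x i" if i: "i < p" for i
    proof -
      have "(\<Sum>j<p. S i j * y j) = (\<Sum>k<p. \<Sum>j<p. S i j * (?V j k * x k))"
        unfolding y_def sum_distrib_left by (rule sum.swap)
      also have "\<dots> = (\<Sum>k<p. mmul p S ?V i k * x k)"
        by (simp add: mmul_def sum_distrib_right mult.assoc)
      also have "\<dots> = (\<Sum>k<p. (if i = k then 1 else 0) * x k)"
        using inv i by (simp add: is_inverse_def)
      also have "\<dots> = x i" using i by (simp add: if_distrib[of "\<lambda>x. x * _"] cong: if_cong)
      finally show ?thesis .
    qed
    have "\<exists>i<p. y i \<noteq> 0"
    proof (rule ccontr)
      assume "\<not> (\<exists>i<p. y i \<noteq> 0)"
      with Sy x show False by fastforce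
    qed
    then have "0 < qf p S y y"
      using S by (auto simp: sym_pos_def_def)
    also have "qf p S y y = (\<Sum>i<p. y i * (\<Sum>j<p. S i j * y j))"
      by (simp add: qf_def sum_distrib_left mult.assoc)
    also have "\<dots> = qf p ?V x x"
      using Sy by (simp add: y_def qf_def sum_distrib_left sum_distrib_right mult_ac)
    finally show ?thesis .
  qed
  ultimately show ?thesis by (simp add: sym_pos_def_def)
qed

section \<open>Whitening by completing squares\<close>

definition mv :: "nat \<Rightarrow> (nat \<Rightarrow> nat \<Rightarrow> real) \<Rightarrow> (nat \<Rightarrow> real) \<Rightarrow> nat \<Rightarrow> real" where
  "mv p C x k = (\<Sum>j<p. C k j * x j)"

lemma sets_PiM_lborel [measurable_cong]:
  "sets (PiM I (\<lambda>_. lborel :: real measure)) = sets (PiM I (\<lambda>_. borel))"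
  by (intro sets_PiM_cong) auto

lemma measurable_mv [measurable]:
  "(\<lambda>x. mv p C x k) \<in> borel_measurable (PiM {..<p} (\<lambda>_. borel))"
  unfolding mv_def by measurable

text \<open>Elimination of the last variable: the shift of \<open>x p\<close> absorbs the mixed
  terms and leaves the Schur complement of the pivot \<open>V p p\<close> on the first
  \<open>p\<close> coordinates. The form is bilinear because the estimator contains inner products
  of two different vectors.\<close>

lemma qf_Suc_complete_square:
  assumes V: "sym_pos_def (Suc p) V"
  shows "V p p > 0"
    and "qf (Suc p) V x y = qf p (\<lambda>i j. V i j - V i p * V p j / V p p) x y
      + V p p * (x p + (\<Sum>j<p. V p j * x j) / V p p) * (y p + (\<Sum>j<p. V p j * y j) / V p p)"
proof -
  have sym: "V i p = V p i" if "i < p" for i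
    using V that by (simp add: sym_pos_def_def)
  \<comment> \<open>The pivot is the value of the form at the last unit vector.\<close>
  have "qf (Suc p) V (\<lambda>i. if i = p then 1 else 0) (\<lambda>i. if i = p then 1 else 0) > 0"
    using V by (auto simp: sym_pos_def_def)
  moreover have "qf (Suc p) V (\<lambda>i. if i = p then 1 else 0) (\<lambda>i. if i = p then 1 else 0) = V p p"
    by (simp add: qf_def)
  ultimately show v: "V p p > 0" by simp
  define bx where "bx = (\<Sum>j<p. V p j * x j)"
  define b_y where "b_y = (\<Sum>j<p. V p j * y j)"
  have "(\<Sum>i<p. \<Sum>j<p. x i * (V i p * V p j / V p p) * y j) = bx * b_y / V p p"
    unfolding bx_def b_y_def sum_product sum_divide_distrib
    by (intro sum.cong refl) (simp add: sym)
  then have W: "qf p (\<lambda>i j. V i j - V i p * V p j / V p p) x y = qf p V x y - bx * b_y / V p p"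
    by (simp add: qf_def algebra_simps sum_subtractf)
  have "qf (Suc p) V x y = qf p V x y + y p * bx + x p * b_y + x p * V p p * y p"
    by (simp add: qf_def sum.distrib bx_def b_y_def sum_distrib_left sym mult_ac)
  then show "qf (Suc p) V x y = qf p (\<lambda>i j. V i j - V i p * V p j / V p p) x y
      + V p p * (x p + (\<Sum>j<p. V p j * x j) / V p p) * (y p + (\<Sum>j<p. V p j * y j) / V p p)"
    using v unfolding W bx_def[symmetric] b_y_def[symmetric] by (simp add: field_simps)
qed

lemma sym_pos_def_schur:
  assumes V: "sym_pos_def (Suc p) V"
  shows "sym_pos_def p (\<lambda>i j. V i j - V i p * V p j / V p p)" (is "sym_pos_def p ?W")
proof -
  have "qf p ?W x x > 0" if "\<exists>i<p. x i \<noteq> 0" for x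
  proof -
    \<comment> \<open>The last coordinate is chosen so that the completed square vanishes; the form
      of \<open>V\<close> at \<open>z\<close> is then the form of the Schur complement at
      \<open>x\<close>.\<close>
    define z where "z = x(p := - (\<Sum>j<p. V p j * x j) / V p p)"
    have "qf (Suc p) V z z > 0"
    proof -
      obtain i where "i < p" "x i \<noteq> 0" using \<open>\<exists>i<p. x i \<noteq> 0\<close> by blast
      then have "\<exists>i<Suc p. z i \<noteq> 0" by (intro exI[of _ i]) (auto simp: z_def)
      with V show ?thesis by (auto simp: sym_pos_def_def)
    qed
    also have "qf (Suc p) V z z = qf p ?W z z"
      by (subst qf_Suc_complete_square[OF V]) (simp add: z_def)
    also have "\<dots> = qf p ?W x x"
      by (simp add: qf_def z_def)
    finally show ?thesis .
  qed
  with V show ?thesis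
    by (auto simp: sym_pos_def_def)
qed

text \<open>Iterated elimination is a factorization of Cholesky type: the \<open>C\<close>
  constructed here is triangular with the square roots of the pivots on the diagonal, and \<kappa>
  is the product of their inverses, that is 1/det C. Each row involves only its own and earlier
  coordinates, so the change of variables is a one-dimensional affine substitution per
  coordinate.\<close>

lemma complete_squares:
  assumes "sym_pos_def p V"
  obtains C \<kappa> where "\<And>x y. qf p V x y = (\<Sum>k<p. mv p C x k * mv p C y k)" "0 < \<kappa>"
    "\<And>h. h \<in> borel_measurable (PiM {..<p} (\<lambda>_. borel)) \<Longrightarrow>
      (\<integral>\<^sup>+x. h (\<lambda>k\<in>{..<p}. mv p C x k) \<partial>PiM {..<p} (\<lambda>_. lborel)) =
        ennreal \<kappa> * (\<integral>\<^sup>+x. h x \<partial>PiM {..<p} (\<lambda>_. lborel))"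
proof -
  interpret L: product_sigma_finite "\<lambda>_. lborel :: real measure" by standard
  have "\<exists>C \<kappa>. (\<forall>x y. qf p V x y = (\<Sum>k<p. mv p C x k * mv p C y k)) \<and> 0 < \<kappa> \<and>
    (\<forall>h\<in>borel_measurable (PiM {..<p} (\<lambda>_. borel)).
      (\<integral>\<^sup>+x. h (\<lambda>k\<in>{..<p}. mv p C x k) \<partial>PiM {..<p} (\<lambda>_. lborel)) =
        ennreal \<kappa> * (\<integral>\<^sup>+x. h x \<partial>PiM {..<p} (\<lambda>_. lborel)))"
    using assms
  proof (induction p arbitrary: V)
    case 0
    show ?case
      by (intro exI[of _ "\<lambda>_ _. 0"] exI[of _ 1])
         (auto simp: qf_def PiM_empty nn_integral_count_space_finite restrict_def)
  next
    case (Suc p)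
    let ?W = "\<lambda>i j. V i j - V i p * V p j / V p p"
    define v where "v = V p p"
    have v: "v > 0" using qf_Suc_complete_square(1)[OF Suc.prems] by (simp add: v_def)
    from Suc.IH[OF sym_pos_def_schur[OF Suc.prems]] obtain C \<kappa> where
      qfW: "\<And>x y. qf p ?W x y = (\<Sum>k<p. mv p C x k * mv p C y k)" and \<kappa>: "0 < \<kappa>" and
      IH: "\<And>h. h \<in> borel_measurable (PiM {..<p} (\<lambda>_. borel)) \<Longrightarrow>
      (\<integral>\<^sup>+x. h (\<lambda>k\<in>{..<p}. mv p C x k) \<partial>PiM {..<p} (\<lambda>_. lborel)) =
        ennreal \<kappa> * (\<integral>\<^sup>+x. h x \<partial>PiM {..<p} (\<lambda>_. lborel))"
      by blast
    \<comment> \<open>The new last row is the completed square, scaled by \<open>sqrt v\<close>; the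
      earlier rows get a zero in the new column.\<close>
    define C' where "C' k j = (if k = p then (if j = p then sqrt v else V p j / sqrt v)
      else (if j = p then 0 else C k j))" for k j
    define \<beta> where "\<beta> x = (\<Sum>j<p. V p j * x j) / sqrt v" for x :: "nat \<Rightarrow> real"
    have C'_less: "mv (Suc p) C' x k = mv p C x k" if "k < p" for x k
      using that by (simp add: mv_def C'_def)
    have C'_p: "mv (Suc p) C' x p = \<beta> x + sqrt v * x p" for x
      by (simp add: mv_def C'_def \<beta>_def sum_divide_distrib)
    have C'_p': "mv (Suc p) C' x p = sqrt v * (x p + (\<Sum>j<p. V p j * x j) / v)" for x
      unfolding C'_p \<beta>_def using v
      by (simp add: field_simps flip: power2_eq_square)
    have "qf (Suc p) V x y = (\<Sum>k<Suc p. mv (Suc p) C' x k * mv (Suc p) C' y k)" for x y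
      unfolding qf_Suc_complete_square(2)[OF Suc.prems] qfW
      using v by (simp add: C'_less C'_p' v_def[symmetric] mult_ac flip: mult.assoc[of "sqrt v" "sqrt v"])
    moreover have "(\<integral>\<^sup>+x. h (\<lambda>k\<in>{..<Suc p}. mv (Suc p) C' x k) \<partial>PiM {..<Suc p} (\<lambda>_. lborel)) =
        ennreal (\<kappa> / sqrt v) * (\<integral>\<^sup>+x. h x \<partial>PiM {..<Suc p} (\<lambda>_. lborel))"
      if h: "h \<in> borel_measurable (PiM {..<Suc p} (\<lambda>_. borel))" for h
    proof -
      note h' [measurable] = h[unfolded lessThan_Suc]
      \<comment> \<open>With the last coordinate integrated out, the induction hypothesis applies to
        a function of the first \<open>p\<close> coordinates.\<close>
      define g where "g z = (\<integral>\<^sup>+y. h (z(p := y)) \<partial>lborel)" for z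
      have g[measurable]: "g \<in> borel_measurable (PiM {..<p} (\<lambda>_. borel))"
        unfolding g_def by measurable
      have "(\<integral>\<^sup>+x. h (\<lambda>k\<in>{..<Suc p}. mv (Suc p) C' x k) \<partial>PiM {..<Suc p} (\<lambda>_. lborel))
        = (\<integral>\<^sup>+x. \<integral>\<^sup>+y. h (\<lambda>k\<in>{..<Suc p}. mv (Suc p) C' (x(p := y)) k) \<partial>lborel
            \<partial>PiM {..<p} (\<lambda>_. lborel))"
        unfolding lessThan_Suc
        by (subst L.product_nn_integral_insert)
           (auto simp flip: lessThan_Suc intro!: measurable_compose[OF _ h] measurable_restrict)
      also have "\<dots> = (\<integral>\<^sup>+x. ennreal (1 / sqrt v) * g (\<lambda>k\<in>{..<p}. mv p C x k)
            \<partial>PiM {..<p} (\<lambda>_. lborel))"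
      proof (intro nn_integral_cong)
        fix x :: "nat \<Rightarrow> real"
        let ?z = "\<lambda>k\<in>{..<p}. mv p C x k"
        have "?z \<in> space (PiM {..<p} (\<lambda>_. borel))" by (simp add: space_PiM)
        then have hz [measurable]: "(\<lambda>y. h (?z(p := y))) \<in> borel_measurable borel"
          by (intro measurable_compose[OF _ h'] measurable_component_update) (assumption | simp)+
        have "(\<lambda>k\<in>{..<Suc p}. mv (Suc p) C' (x(p := y)) k) = ?z(p := \<beta> x + sqrt v * y)" for y
        proof -
          have "mv p C (x(p := y)) k = mv p C x k" for k by (simp add: mv_def)
          moreover have "\<beta> (x(p := y)) = \<beta> x" by (simp add: \<beta>_def)
          ultimately show ?thesis
            by (auto simp: fun_eq_iff C'_less C'_p restrict_def less_Suc_eq)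
        qed
        then have "(\<integral>\<^sup>+y. h (\<lambda>k\<in>{..<Suc p}. mv (Suc p) C' (x(p := y)) k) \<partial>lborel)
          = (\<integral>\<^sup>+y. h (?z(p := \<beta> x + sqrt v * y)) \<partial>lborel)" by simp
        also have "\<dots> = ennreal (1 / sqrt v) * (ennreal \<bar>sqrt v\<bar> * (\<integral>\<^sup>+y. h (?z(p := \<beta> x + sqrt v * y)) \<partial>lborel))"
          using v by (simp add: mult.assoc[symmetric] ennreal_mult[symmetric])
        also have "\<dots> = ennreal (1 / sqrt v) * g ?z"
          unfolding g_def using v nn_integral_real_affine[OF hz, of "sqrt v" "\<beta> x"] by simp
        finally show "(\<integral>\<^sup>+y. h (\<lambda>k\<in>{..<Suc p}. mv (Suc p) C' (x(p := y)) k) \<partial>lborel)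
          = ennreal (1 / sqrt v) * g ?z" .
      qed
      also have "\<dots> = ennreal (1 / sqrt v) * (ennreal \<kappa> * (\<integral>\<^sup>+x. g x \<partial>PiM {..<p} (\<lambda>_. lborel)))"
        by (subst nn_integral_cmult) (auto simp: IH)
      also have "(\<integral>\<^sup>+x. g x \<partial>PiM {..<p} (\<lambda>_. lborel)) = (\<integral>\<^sup>+x. h x \<partial>PiM {..<Suc p} (\<lambda>_. lborel))"
        unfolding lessThan_Suc g_def by (subst L.product_nn_integral_insert) auto
      also have "ennreal (1 / sqrt v) * (ennreal \<kappa> * (\<integral>\<^sup>+x. h x \<partial>PiM {..<Suc p} (\<lambda>_. lborel)))
        = ennreal (\<kappa> / sqrt v) * (\<integral>\<^sup>+x. h x \<partial>PiM {..<Suc p} (\<lambda>_. lborel))"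
        using v \<kappa> by (simp add: mult.assoc[symmetric] ennreal_mult[symmetric])
      finally show ?thesis .
    qed
    moreover have "\<kappa> / sqrt v > 0" using v \<kappa> by simp
    ultimately show ?case by blast
  qed
  then show ?thesis using that by blast
qed

section \<open>Products of standard normal distributions\<close>

abbreviation gauss :: "'a set \<Rightarrow> ('a \<Rightarrow> real) measure" where
  "gauss K \<equiv> PiM K (\<lambda>_. std_normal_distribution)"

lemma prob_space_std_normal: "prob_space std_normal_distribution"
  by (rule prob_space_normal_density) simp

lemma prob_space_gauss: "prob_space (gauss K)"
  by (intro prob_space_PiM prob_space_std_normal)

lemma sets_gauss [measurable_cong]: "sets (gauss K) = sets (PiM K (\<lambda>_. borel))"
  by (intro sets_PiM_cong) auto

text \<open>A product measure is determined by its values on boxes, and on a box the integral of the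
  product density factorizes.\<close>

lemma PiM_density:
  assumes K: "finite K"
    and f: "\<And>k. k \<in> K \<Longrightarrow> f k \<in> borel_measurable lborel"
    and prob: "\<And>k. k \<in> K \<Longrightarrow> prob_space (density lborel (f k))"
  shows "PiM K (\<lambda>k. density lborel (f k)) =
    density (PiM K (\<lambda>_. lborel :: real measure)) (\<lambda>x. \<Prod>k\<in>K. f k (x k))"
proof -
  \<comment> \<open>Product measure facts ask for sigma-finite factors at every index of the type;
    outside \<open>K\<close> a point mass is put in.\<close>
  define D where "D k = (if k \<in> K then density lborel (f k) else return lborel 0)" for k
  have D: "prob_space (D k)" for k
    unfolding D_def using prob by (auto intro: prob_space_return)
  then interpret D: product_sigma_finite D
    by (simp add: product_sigma_finite_def prob_space_imp_sigma_finite)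
  interpret L: product_sigma_finite "\<lambda>_. lborel :: real measure" by standard
  have [measurable]: "(\<lambda>x. \<Prod>k\<in>K. f k (x k)) \<in> borel_measurable (PiM K (\<lambda>_. lborel))"
    using f by (intro borel_measurable_prod_ennreal) (auto intro!: measurable_compose[OF measurable_component_singleton])
  have "density (PiM K (\<lambda>_. lborel :: real measure)) (\<lambda>x. \<Prod>k\<in>K. f k (x k)) = PiM K D"
  proof (rule D.PiM_eqI[OF K])
    show "sets (density (PiM K (\<lambda>_. lborel)) (\<lambda>x. \<Prod>k\<in>K. f k (x k))) = sets (PiM K D)"
      by (auto intro!: sets_PiM_cong simp: D_def)
    fix A assume A: "\<And>i. i \<in> K \<Longrightarrow> A i \<in> sets (D i)"
    then have A': "A i \<in> sets borel" if "i \<in> K" for i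
      using that by (force simp: D_def)
    have "emeasure (density (PiM K (\<lambda>_. lborel)) (\<lambda>x. \<Prod>k\<in>K. f k (x k))) (Pi\<^sub>E K A)
      = (\<integral>\<^sup>+x. (\<Prod>k\<in>K. f k (x k)) * indicator (Pi\<^sub>E K A) x \<partial>PiM K (\<lambda>_. lborel))"
      using K A' by (intro emeasure_density) (auto intro!: sets_PiM_I_finite)
    also have "\<dots> = (\<integral>\<^sup>+x. (\<Prod>k\<in>K. f k (x k) * indicator (A k) (x k)) \<partial>PiM K (\<lambda>_. lborel))"
    proof (intro nn_integral_cong)
      fix x assume "x \<in> space (PiM K (\<lambda>_. lborel :: real measure))"
      then have "indicator (Pi\<^sub>E K A) x = (\<Prod>k\<in>K. indicator (A k) (x k) :: ennreal)"
        using K by (auto simp: indicator_def space_PiM PiE_iff prod.neutral)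
      then show "(\<Prod>k\<in>K. f k (x k)) * indicator (Pi\<^sub>E K A) x = (\<Prod>k\<in>K. f k (x k) * indicator (A k) (x k))"
        by (simp add: prod.distrib)
    qed
    also have "\<dots> = (\<Prod>k\<in>K. \<integral>\<^sup>+x. f k x * indicator (A k) x \<partial>lborel)"
      using f A' by (intro L.product_nn_integral_prod[OF K]) auto
    also have "\<dots> = (\<Prod>k\<in>K. emeasure (D k) (A k))"
      using f A' by (intro prod.cong refl) (simp add: D_def emeasure_density)
    finally show "emeasure (density (PiM K (\<lambda>_. lborel)) (\<lambda>x. \<Prod>k\<in>K. f k (x k))) (Pi\<^sub>E K A)
      = (\<Prod>k\<in>K. emeasure (D k) (A k))" .
  qed
  also have "PiM K D = PiM K (\<lambda>k. density lborel (f k))"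
    by (intro PiM_cong) (auto simp: D_def)
  finally show ?thesis ..
qed

text \<open>The preimage of a box under a coordinatewise map is a box, and boxes determine the
  product measure.\<close>

lemma distr_PiM_componentwise:
  assumes K: "finite K"
    and M: "\<And>k. prob_space (M k)"
    and f: "\<And>k. k \<in> K \<Longrightarrow> f k \<in> measurable (M k) (N k)"
  shows "distr (PiM K M) (PiM K N) (\<lambda>x. \<lambda>k\<in>K. f k (x k)) = PiM K (\<lambda>k. distr (M k) (N k) (f k))"
proof -
  \<comment> \<open>Outside \<open>K\<close> the map becomes a constant into a point mass, so that
    every factor of the image is a probability space.\<close>
  define N' where "N' k = (if k \<in> K then N k else return (count_space UNIV) undefined)" for k
  define f' where "f' k = (if k \<in> K then f k else (\<lambda>_. undefined))" for k
  have f': "f' k \<in> measurable (M k) (N' k)" for k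
    using f by (auto simp: f'_def N'_def)
  have "prob_space (distr (M k) (N' k) (f' k))" for k
    by (rule prob_space.prob_space_distr[OF M f'])
  then interpret D: product_sigma_finite "\<lambda>k. distr (M k) (N' k) (f' k)"
    by (simp add: product_sigma_finite_def prob_space_imp_sigma_finite)
  interpret M: product_sigma_finite M
    using M by (simp add: product_sigma_finite_def prob_space_imp_sigma_finite)
  have meas: "(\<lambda>x. \<lambda>k\<in>K. f' k (x k)) \<in> measurable (PiM K M) (PiM K N')"
    by (intro measurable_restrict, rule measurable_compose[OF _ f'], rule measurable_component_singleton)
  have "distr (PiM K M) (PiM K N') (\<lambda>x. \<lambda>k\<in>K. f' k (x k)) = PiM K (\<lambda>k. distr (M k) (N' k) (f' k))"
  proof (rule D.PiM_eqI[OF K])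
    show "sets (distr (PiM K M) (PiM K N') (\<lambda>x. \<lambda>k\<in>K. f' k (x k))) =
        sets (PiM K (\<lambda>k. distr (M k) (N' k) (f' k)))"
      by (simp cong: sets_PiM_cong)
    fix A assume A: "\<And>i. i \<in> K \<Longrightarrow> A i \<in> sets (distr (M i) (N' i) (f' i))"
    have pre: "(\<lambda>x. \<lambda>k\<in>K. f' k (x k)) -` Pi\<^sub>E K A \<inter> space (PiM K M) =
        (\<Pi>\<^sub>E k\<in>K. f' k -` A k \<inter> space (M k))"
      by (auto simp: space_PiM PiE_iff)
    have "emeasure (distr (PiM K M) (PiM K N') (\<lambda>x. \<lambda>k\<in>K. f' k (x k))) (Pi\<^sub>E K A)
      = emeasure (PiM K M) (\<Pi>\<^sub>E k\<in>K. f' k -` A k \<inter> space (M k))"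
      using A by (subst emeasure_distr[OF meas]) (auto simp: pre intro!: sets_PiM_I_finite K)
    also have "\<dots> = (\<Prod>k\<in>K. emeasure (M k) (f' k -` A k \<inter> space (M k)))"
      using A by (intro M.emeasure_PiM K measurable_sets[OF f']) auto
    also have "\<dots> = (\<Prod>k\<in>K. emeasure (distr (M k) (N' k) (f' k)) (A k))"
      using A by (intro prod.cong refl) (simp add: emeasure_distr f')
    finally show "emeasure (distr (PiM K M) (PiM K N') (\<lambda>x. \<lambda>k\<in>K. f' k (x k))) (Pi\<^sub>E K A)
      = (\<Prod>k\<in>K. emeasure (distr (M k) (N' k) (f' k)) (A k))" .
  qed
  moreover have "PiM K N' = PiM K N" "PiM K (\<lambda>k. distr (M k) (N' k) (f' k)) = PiM K (\<lambda>k. distr (M k) (N k) (f k))"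
    "(\<lambda>x. \<lambda>k\<in>K. f' k (x k)) = (\<lambda>x. \<lambda>k\<in>K. f k (x k))"
    by (auto simp: N'_def f'_def fun_eq_iff intro!: PiM_cong)
  ultimately show ?thesis by simp
qed

lemma distr_std_normal_affine:
  assumes "\<sigma> > 0"
  shows "distr std_normal_distribution borel (\<lambda>z. \<mu> + \<sigma> * z) =
    density lborel (\<lambda>x. ennreal (normal_density \<mu> \<sigma> x))"
proof -
  interpret prob_space "std_normal_distribution"
    by (rule prob_space_std_normal)
  have "distributed std_normal_distribution lborel (\<lambda>x. x) (normal_density 0 1)"
    by (auto simp: distributed_def distr_id2)
  from normal_density_affine[OF this, of \<sigma> \<mu>] assms
  have "distributed std_normal_distribution lborel (\<lambda>x. \<mu> + \<sigma> * x) (normal_density \<mu> \<sigma>)"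
    by simp
  then show ?thesis by (simp add: distributed_def cong: distr_cong)
qed

text \<open>For s > 0 this is the convolution of two centered normal densities. The degenerate case
  s = 0 is included because sums of observations are built up from the empty sum, with standard
  deviation \<open>sqrt 0\<close>.\<close>

lemma nn_integral_std_normal_convolution:
  assumes s: "0 \<le> s" and t: "0 < t" and h [measurable]: "h \<in> borel_measurable borel"
  defines "N \<equiv> std_normal_distribution"
  shows "(\<integral>\<^sup>+x. \<integral>\<^sup>+y. h (s * x + t * y) \<partial>N \<partial>N) = (\<integral>\<^sup>+x. h (sqrt (s\<^sup>2 + t\<^sup>2) * x) \<partial>N)"
proof (cases "s = 0")
  case True
  interpret prob_space N unfolding N_def by (rule prob_space_std_normal)
  show ?thesis using True t by (simp add: emeasure_space_1)
next
  case False
  with s have s: "s > 0" by simp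
  have *: "(\<integral>\<^sup>+x. g (\<sigma> * x) \<partial>N) = (\<integral>\<^sup>+x. g x \<partial>density lborel (\<lambda>x. ennreal (normal_density 0 \<sigma> x)))"
    if [measurable]: "g \<in> borel_measurable borel" and "\<sigma> > 0" for g :: "real \<Rightarrow> ennreal" and \<sigma>
    unfolding distr_std_normal_affine[OF that(2), of 0, symmetric] N_def
    by (subst nn_integral_distr) auto
  let ?S = "density lborel (\<lambda>x. ennreal (normal_density 0 s x))"
  let ?T = "density lborel (\<lambda>x. ennreal (normal_density 0 t x))"
  have fin: "finite_measure ?S" "finite_measure ?T"
    using s t by (auto intro!: prob_space.finite_measure prob_space_normal_density)
  interpret T: finite_measure ?T by fact
  have "(\<integral>\<^sup>+x. \<integral>\<^sup>+y. h (s * x + t * y) \<partial>N \<partial>N) = (\<integral>\<^sup>+x. \<integral>\<^sup>+y. h (s * x + y) \<partial>?T \<partial>N)"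
    by (intro nn_integral_cong *) (use t in auto)
  also have "\<dots> = (\<integral>\<^sup>+x. \<integral>\<^sup>+y. h (x + y) \<partial>?T \<partial>?S)"
    by (intro *) (use s in auto)
  also have "\<dots> = (\<integral>\<^sup>+x. h x \<partial>(?S \<star> ?T))"
    using fin by (intro nn_integral_convolution[symmetric]) auto
  also have "?S \<star> ?T = density lborel (\<lambda>x. ennreal (normal_density 0 (sqrt (s\<^sup>2 + t\<^sup>2)) x))"
    using fin s t by (subst convolution_density)
      (auto simp: conv_normal_density_zero_mean[unfolded fun_eq_iff] ennreal_mult''[symmetric])
  also have "(\<integral>\<^sup>+x. h x \<partial>\<dots>) = (\<integral>\<^sup>+x. h (sqrt (s\<^sup>2 + t\<^sup>2) * x) \<partial>N)"
    using s t by (intro *[symmetric]) (auto simp: sum_power2_gt_zero_iff)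
  finally show ?thesis .
qed

text \<open>Induction on the coordinates: coordinate \<open>i\<close> is split off from both vectors
  and handled by the scalar case, the others by the induction hypothesis.\<close>

lemma nn_integral_gauss_convolution:
  assumes "finite K" and s: "0 \<le> s" and t: "0 < t" and "h \<in> borel_measurable (PiM K (\<lambda>_. borel))"
  shows "(\<integral>\<^sup>+z. \<integral>\<^sup>+w. h (\<lambda>k\<in>K. s * z k + t * w k) \<partial>gauss K \<partial>gauss K) =
    (\<integral>\<^sup>+z. h (\<lambda>k\<in>K. sqrt (s\<^sup>2 + t\<^sup>2) * z k) \<partial>gauss K)"
  using assms(1,4)
proof (induction K arbitrary: h)
  case empty
  then show ?case by (simp add: PiM_empty nn_integral_count_space_finite restrict_def)
next
  case (insert i K)
  let ?N = "std_normal_distribution"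
  note h [measurable] = insert.prems
  interpret N: prob_space ?N by (rule prob_space_std_normal)
  interpret G: prob_space "gauss K" by (rule prob_space_gauss)
  interpret G': prob_space "gauss (insert i K)" by (rule prob_space_gauss)
  interpret P: product_sigma_finite "\<lambda>_ :: 'a. ?N" by standard
  interpret pair_sigma_finite ?N "gauss K" by standard
  define r where "r = sqrt (s\<^sup>2 + t\<^sup>2)"
  have upd: "(\<lambda>k\<in>insert i K. f ((z(i := a)) k) ((w(i := b)) k)) = (\<lambda>k\<in>K. f (z k) (w k))(i := f a b)"
    for f :: "real \<Rightarrow> real \<Rightarrow> real" and z w :: "'a \<Rightarrow> real" and a b
    using insert.hyps by (auto simp: fun_eq_iff)
  have "(\<integral>\<^sup>+z. \<integral>\<^sup>+w. h (\<lambda>k\<in>insert i K. s * z k + t * w k) \<partial>gauss (insert i K) \<partial>gauss (insert i K))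
    = (\<integral>\<^sup>+z. \<integral>\<^sup>+a. \<integral>\<^sup>+w. h (\<lambda>k\<in>insert i K. s * (z(i := a)) k + t * w k) \<partial>gauss (insert i K) \<partial>?N \<partial>gauss K)"
    by (subst P.product_nn_integral_insert[OF insert.hyps]) auto
  also have "\<dots> = (\<integral>\<^sup>+z. \<integral>\<^sup>+a. \<integral>\<^sup>+w. \<integral>\<^sup>+b. h ((\<lambda>k\<in>K. s * z k + t * w k)(i := s * a + t * b)) \<partial>?N \<partial>gauss K \<partial>?N \<partial>gauss K)"
    by (subst P.product_nn_integral_insert[OF insert.hyps]; (simp only: upd[of "\<lambda>x y. s * x + t * y"])?; measurable)
  \<comment> \<open>Exchanging \<open>a\<close> with \<open>w\<close> brings the two integrals over
    coordinate \<open>i\<close> next to each other.\<close>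
  also have "\<dots> = (\<integral>\<^sup>+z. \<integral>\<^sup>+w. \<integral>\<^sup>+a. \<integral>\<^sup>+b. h ((\<lambda>k\<in>K. s * z k + t * w k)(i := s * a + t * b)) \<partial>?N \<partial>?N \<partial>gauss K \<partial>gauss K)"
    by (rule nn_integral_cong, rule Fubini'[symmetric]) measurable
  also have "\<dots> = (\<integral>\<^sup>+z. \<integral>\<^sup>+w. \<integral>\<^sup>+a. h ((\<lambda>k\<in>K. s * z k + t * w k)(i := r * a)) \<partial>?N \<partial>gauss K \<partial>gauss K)"
    unfolding r_def
    by (intro nn_integral_cong nn_integral_std_normal_convolution s t
          measurable_compose[OF _ h] measurable_component_update) (auto simp: space_PiM insert.hyps)
  also have "\<dots> = (\<integral>\<^sup>+z. \<integral>\<^sup>+a. h ((\<lambda>k\<in>K. r * z k)(i := r * a)) \<partial>?N \<partial>gauss K)"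
    unfolding r_def by (rule insert.IH) measurable
  also have "\<dots> = (\<integral>\<^sup>+z. h (\<lambda>k\<in>insert i K. r * z k) \<partial>gauss (insert i K))"
    by (subst P.product_nn_integral_insert[OF insert.hyps]; (simp only: upd[of "\<lambda>x y. r * x"])?; measurable)
  finally show ?case unfolding r_def .
qed

section \<open>The law of a whitened sample mean\<close>

lemma measurable_restrict_mv [measurable]:
  "(\<lambda>x. restrict (mv p C x) {..<p}) \<in> measurable (PiM {..<p} (\<lambda>_. borel)) (PiM {..<p} (\<lambda>_. borel))"
  by (intro measurable_restrict measurable_mv)

lemma mv_diff: "mv p C (\<lambda>k. x k - y k) i = mv p C x i - mv p C y i"
  by (simp add: mv_def algebra_simps sum_subtractf)

lemma mv_sample_mean: "mv p C (sample_mean n X) k = (\<Sum>t<n. mv p C (X t) k) / real n"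
proof -
  have "mv p C (sample_mean n X) k = (\<Sum>j<p. \<Sum>t<n. C k j * X t j / real n)"
    by (simp add: mv_def sample_mean_def sum_divide_distrib sum_distrib_left)
  also have "\<dots> = (\<Sum>t<n. \<Sum>j<p. C k j * X t j / real n)"
    by (rule sum.swap)
  finally show ?thesis by (simp add: mv_def sum_divide_distrib)
qed

lemma sets_mvnormal [measurable_cong]: "sets (mvnormal p m S) = sets (PiM {..<p} (\<lambda>_. borel))"
  by (simp add: mvnormal_def Let_def sets_PiM_lborel)

text \<open>A matrix \<open>C\<close> with \<open>C\<^sup>T C = S\<^sup>-\<^sup>1\<close>, so that \<open>x \<mapsto> C x\<close> turns the covariance \<open>S\<close> into the
  identity.  Its inverse is never needed; all that is used is how it transforms Lebesgue measure.\<close>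

locale whitening =
  fixes p :: nat and S C :: "nat \<Rightarrow> nat \<Rightarrow> real" and \<kappa> :: real
  assumes spd: "sym_pos_def p S"
    and qf_minv: "qf p (minv p S) x y = (\<Sum>k<p. mv p C x k * mv p C y k)"
    and \<kappa>_pos: "0 < \<kappa>"
    and nn_integral_mv: "h \<in> borel_measurable (PiM {..<p} (\<lambda>_. borel)) \<Longrightarrow>
      (\<integral>\<^sup>+x. h (restrict (mv p C x) {..<p}) \<partial>PiM {..<p} (\<lambda>_. lborel)) =
        ennreal \<kappa> * (\<integral>\<^sup>+x. h x \<partial>PiM {..<p} (\<lambda>_. lborel))"
begin

text \<open>The restriction makes the whitened vector a point of the product space, whose elements
  are \<open>undefined\<close> outside \<open>{..<p}\<close>.\<close>

abbreviation wh :: "(nat \<Rightarrow> real) \<Rightarrow> nat \<Rightarrow> real" where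
  "wh x \<equiv> restrict (mv p C x) {..<p}"

abbreviation B :: "(nat \<Rightarrow> real) measure" where
  "B \<equiv> PiM {..<p} (\<lambda>_. borel)"

text \<open>The Gaussian exponential is a constant times \<psi>, a product of one-dimensional normal
  densities, at the whitened point. By the second claim \<psi> is a probability density, and this
  evaluates the normalizing integral in \<open>mvnormal\<close>.\<close>

lemma mvnormal_eq_density:
  fixes a :: real
  assumes a: "a > 0"
  defines "\<psi> \<equiv> \<lambda>m y. \<Prod>k<p. normal_density (mv p C m k) (sqrt a) (y k)"
  shows "mvnormal p m (scale_mat a S) =
    density (PiM {..<p} (\<lambda>_. lborel)) (\<lambda>x. ennreal (\<psi> m (wh x) / \<kappa>))"
    and "density (PiM {..<p} (\<lambda>_. lborel)) (\<lambda>y. ennreal (\<psi> m y)) =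
      distr (gauss {..<p}) B (\<lambda>z. \<lambda>k\<in>{..<p}. mv p C m k + sqrt a * z k)"
proof -
  have [measurable]: "\<psi> m \<in> borel_measurable B" for m
    unfolding \<psi>_def by measurable
  have \<psi>_nonneg: "0 \<le> \<psi> m y" for y
    by (simp add: \<psi>_def prod_nonneg)
  let ?D = "\<lambda>k. density lborel (\<lambda>x. ennreal (normal_density (mv p C m k) (sqrt a) x))"
  have "density (PiM {..<p} (\<lambda>_. lborel)) (\<lambda>y. ennreal (\<psi> m y)) = PiM {..<p} ?D"
    using a by (subst PiM_density) (auto intro!: prob_space_normal_density simp: \<psi>_def prod_ennreal)
  also have "?D = (\<lambda>k. distr std_normal_distribution borel (\<lambda>z. mv p C m k + sqrt a * z))"
    using a by (simp add: distr_std_normal_affine)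
  also have "PiM {..<p} \<dots> = distr (gauss {..<p}) B (\<lambda>z. \<lambda>k\<in>{..<p}. mv p C m k + sqrt a * z k)"
    by (rule distr_PiM_componentwise[symmetric]) (auto intro: prob_space_std_normal)
  finally show *: "density (PiM {..<p} (\<lambda>_. lborel)) (\<lambda>y. ennreal (\<psi> m y)) =
      distr (gauss {..<p}) B (\<lambda>z. \<lambda>k\<in>{..<p}. mv p C m k + sqrt a * z k)" .
  have "prob_space (distr (gauss {..<p}) B (\<lambda>z. \<lambda>k\<in>{..<p}. mv p C m k + sqrt a * z k))"
    by (rule prob_space.prob_space_distr[OF prob_space_gauss]) measurable
  from prob_space.emeasure_space_1[OF this[folded *]]
  have \<psi>_1: "(\<integral>\<^sup>+y. ennreal (\<psi> m y) \<partial>PiM {..<p} (\<lambda>_. lborel)) = 1"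
    by (simp add: emeasure_density cong: nn_integral_cong)
  \<comment> \<open>The product of the \<open>p\<close> normalizing constants of the one-dimensional
    densities.\<close>
  define K where "K = sqrt (2 * pi * a) ^ p"
  have K: "K > 0" using a by (simp add: K_def)
  define g where "g x = exp (- qf p (minv p (scale_mat a S)) (\<lambda>k. x k - m k) (\<lambda>k. x k - m k) / 2)" for x
  have g: "g x = K * \<psi> m (wh x)" for x
  proof -
    have "qf p (minv p (scale_mat a S)) (\<lambda>k. x k - m k) (\<lambda>k. x k - m k)
      = (\<Sum>k<p. (mv p C x k - mv p C m k)\<^sup>2) / a"
      using qf_cong[where A = "minv p (scale_mat a S)" and B = "\<lambda>i j. minv p S i j / a", OF minv_scale_mat[OF spd a]]
      by (simp add: qf_scale_right qf_minv mv_diff power2_eq_square)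
    then have "g x = exp (\<Sum>k<p. - (mv p C x k - mv p C m k)\<^sup>2 / (2 * a))"
      by (simp add: g_def sum_divide_distrib sum_negf mult.commute)
    also have "\<dots> = (\<Prod>k<p. exp (- (mv p C x k - mv p C m k)\<^sup>2 / (2 * a)))"
      by (simp add: exp_sum)
    also have "\<dots> = (\<Prod>k<p. sqrt (2 * pi * a) * normal_density (mv p C m k) (sqrt a) (mv p C x k))"
      using a by (intro prod.cong refl) (simp add: normal_density_def)
    also have "\<dots> = K * \<psi> m (wh x)"
      by (simp add: prod.distrib K_def \<psi>_def)
    finally show ?thesis .
  qed
  have [measurable]: "g \<in> borel_measurable B"
    unfolding g[abs_def] by measurable
  \<comment> \<open>Substituting the whitened variable evaluates the normalizer as \<open>K\<close>
    times \<kappa>; then \<open>K\<close> cancels and 1/\<kappa> stays in the density.\<close>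
  have "(\<integral>\<^sup>+x. ennreal (g x) \<partial>PiM {..<p} (\<lambda>_. lborel)) = ennreal K * (ennreal \<kappa> * 1)"
    unfolding g \<psi>_1[symmetric] using K \<psi>_nonneg
    by (simp add: ennreal_mult nn_integral_cmult nn_integral_mv[of "\<lambda>y. ennreal (\<psi> m y)"])
  then have "integral\<^sup>L (PiM {..<p} (\<lambda>_. lborel)) g = K * \<kappa>"
    using K \<kappa>_pos by (subst integral_eq_nn_integral) (auto simp: g_def ennreal_mult[symmetric])
  then have "mvnormal p m (scale_mat a S) = density (PiM {..<p} (\<lambda>_. lborel)) (\<lambda>x. ennreal (g x / (K * \<kappa>)))"
    unfolding mvnormal_def Let_def g_def[symmetric, abs_def] by simp
  then show "mvnormal p m (scale_mat a S) =
    density (PiM {..<p} (\<lambda>_. lborel)) (\<lambda>x. ennreal (\<psi> m (wh x) / \<kappa>))"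
    using K by (simp add: g)
qed

text \<open>The factor 1/\<kappa> of the density cancels against the Jacobian factor \<kappa> of the
  whitening map.\<close>

lemma distr_mvnormal:
  assumes a: "a > 0"
  shows "distr (mvnormal p m (scale_mat a S)) B wh =
    distr (gauss {..<p}) B (\<lambda>z. \<lambda>k\<in>{..<p}. mv p C m k + sqrt a * z k)"
proof -
  define \<psi> where "\<psi> y = (\<Prod>k<p. normal_density (mv p C m k) (sqrt a) (y k))" for y
  have [measurable]: "\<psi> \<in> borel_measurable B"
    unfolding \<psi>_def by measurable
  have \<psi>_nonneg: "0 \<le> \<psi> y" for y
    by (simp add: \<psi>_def prod_nonneg)
  have "distr (mvnormal p m (scale_mat a S)) B wh = density (PiM {..<p} (\<lambda>_. lborel)) (\<lambda>y. ennreal (\<psi> y))"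
  proof (rule measure_eqI)
    fix A assume "A \<in> sets (distr (mvnormal p m (scale_mat a S)) B wh)"
    then have A [measurable]: "A \<in> sets B" by simp
    have "emeasure (distr (mvnormal p m (scale_mat a S)) B wh) A =
      (\<integral>\<^sup>+x. indicator A (wh x) \<partial>mvnormal p m (scale_mat a S))"
      by (simp add: nn_integral_distr flip: nn_integral_indicator)
    also have "\<dots> = (\<integral>\<^sup>+x. ennreal (\<psi> (wh x) / \<kappa>) * indicator A (wh x) \<partial>PiM {..<p} (\<lambda>_. lborel))"
      unfolding mvnormal_eq_density(1)[OF a] \<psi>_def[symmetric] by (subst nn_integral_density) auto
    also have "\<dots> = ennreal \<kappa> * (\<integral>\<^sup>+y. ennreal (\<psi> y / \<kappa>) * indicator A y \<partial>PiM {..<p} (\<lambda>_. lborel))"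
      by (rule nn_integral_mv) measurable
    also have "\<dots> = (\<integral>\<^sup>+y. ennreal (\<psi> y) * indicator A y \<partial>PiM {..<p} (\<lambda>_. lborel))"
      using \<kappa>_pos \<psi>_nonneg
      by (subst nn_integral_cmult[symmetric]) (auto simp: mult.assoc[symmetric] ennreal_mult[symmetric])
    also have "\<dots> = emeasure (density (PiM {..<p} (\<lambda>_. lborel)) (\<lambda>y. ennreal (\<psi> y))) A"
      by (subst emeasure_density) auto
    finally show "emeasure (distr (mvnormal p m (scale_mat a S)) B wh) A =
      emeasure (density (PiM {..<p} (\<lambda>_. lborel)) (\<lambda>y. ennreal (\<psi> y))) A" .
  qed (simp add: sets_PiM_lborel)
  then show ?thesis
    unfolding \<psi>_def mvnormal_eq_density(2)[OF a] .
qed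

text \<open>The total mass is read off from the image under \<open>wh\<close>, which is the law of a
  Gaussian vector.\<close>

lemma prob_space_mvnormal:
  assumes "a > 0"
  shows "prob_space (mvnormal p m (scale_mat a S))"
proof
  interpret prob_space "distr (gauss {..<p}) B (\<lambda>z. \<lambda>k\<in>{..<p}. mv p C m k + sqrt a * z k)"
    by (rule prob_space.prob_space_distr[OF prob_space_gauss]) measurable
  have "emeasure (distr (mvnormal p m (scale_mat a S)) B wh) (space B) = 1"
    using emeasure_space_1 unfolding distr_mvnormal[OF assms] by simp
  moreover have "wh -` space B \<inter> space (mvnormal p m (scale_mat a S)) = space (mvnormal p m (scale_mat a S))"
    by (auto simp: space_PiM)
  ultimately show "emeasure (mvnormal p m (scale_mat a S)) (space (mvnormal p m (scale_mat a S))) = 1"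
    by (simp add: emeasure_distr)
qed

lemma scale_mat_1: "scale_mat 1 S = S"
  by (simp add: scale_mat_def fun_eq_iff)

text \<open>Sums fit the induction better than means: the next observation adds variance 1 to the
  accumulated variance \<open>n\<close>, by the convolution lemma with s = \<open>sqrt n\<close> and
  t = 1.\<close>

lemma nn_integral_sum_mvnormal:
  assumes "h \<in> borel_measurable B"
  shows "(\<integral>\<^sup>+X. h (\<lambda>k\<in>{..<p}. \<Sum>t<n. mv p C (X t) k) \<partial>PiM {..<n} (\<lambda>_. mvnormal p \<mu> S)) =
    (\<integral>\<^sup>+z. h (\<lambda>k\<in>{..<p}. real n * mv p C \<mu> k + sqrt n * z k) \<partial>gauss {..<p})"
  using assms
proof (induction n arbitrary: h)
  case 0
  interpret G: prob_space "gauss {..<p}" by (rule prob_space_gauss)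
  show ?case by (simp add: PiM_empty nn_integral_count_space_finite G.emeasure_space_1)
next
  case (Suc n)
  note [measurable] = Suc.prems
  interpret mvn: prob_space "mvnormal p \<mu> S"
    using prob_space_mvnormal[of 1 \<mu>] by (simp add: scale_mat_1)
  interpret M: product_sigma_finite "\<lambda>_ :: nat. mvnormal p \<mu> S" by standard
  interpret G: prob_space "gauss {..<p}" by (rule prob_space_gauss)
  have meas: "(\<lambda>X. h (\<lambda>k\<in>{..<p}. \<Sum>t<Suc n. mv p C (X t) k)) \<in> borel_measurable (PiM {..<Suc n} (\<lambda>_. mvnormal p \<mu> S))"
    by measurable
  have "(\<integral>\<^sup>+X. h (\<lambda>k\<in>{..<p}. \<Sum>t<Suc n. mv p C (X t) k) \<partial>PiM {..<Suc n} (\<lambda>_. mvnormal p \<mu> S)) =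
    (\<integral>\<^sup>+X. \<integral>\<^sup>+x. h (\<lambda>k\<in>{..<p}. (\<Sum>t<n. mv p C (X t) k) + mv p C x k) \<partial>mvnormal p \<mu> S \<partial>PiM {..<n} (\<lambda>_. mvnormal p \<mu> S))"
    using meas unfolding lessThan_Suc by (subst M.product_nn_integral_insert) (auto simp: add.commute)
  also have "\<dots> = (\<integral>\<^sup>+X. \<integral>\<^sup>+z. h (\<lambda>k\<in>{..<p}. (\<Sum>t<n. mv p C (X t) k) + mv p C \<mu> k + z k)
      \<partial>gauss {..<p} \<partial>PiM {..<n} (\<lambda>_. mvnormal p \<mu> S))"
  proof (intro nn_integral_cong)
    fix X :: "nat \<Rightarrow> nat \<Rightarrow> real"
    let ?h = "\<lambda>y. h (\<lambda>k\<in>{..<p}. (\<Sum>t<n. mv p C (X t) k) + y k)"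
    have "(\<integral>\<^sup>+x. h (\<lambda>k\<in>{..<p}. (\<Sum>t<n. mv p C (X t) k) + mv p C x k) \<partial>mvnormal p \<mu> S)
      = (\<integral>\<^sup>+x. ?h (wh x) \<partial>mvnormal p \<mu> (scale_mat 1 S))"
      by (simp add: scale_mat_1 cong: restrict_cong)
    also have "\<dots> = (\<integral>\<^sup>+y. ?h y \<partial>distr (mvnormal p \<mu> (scale_mat 1 S)) B wh)"
      by (rule nn_integral_distr[symmetric]) measurable
    also have "\<dots> = (\<integral>\<^sup>+z. h (\<lambda>k\<in>{..<p}. (\<Sum>t<n. mv p C (X t) k) + mv p C \<mu> k + z k) \<partial>gauss {..<p})"
      unfolding distr_mvnormal[of 1, simplified]
      by (subst nn_integral_distr) (auto simp: add.assoc cong: restrict_cong)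
    finally show "(\<integral>\<^sup>+x. h (\<lambda>k\<in>{..<p}. (\<Sum>t<n. mv p C (X t) k) + mv p C x k) \<partial>mvnormal p \<mu> S) = \<dots>" .
  qed
  \<comment> \<open>The new observation, already integrated out, becomes part of the test function
    for the induction hypothesis.\<close>
  also have "\<dots> = (\<integral>\<^sup>+X. (\<lambda>y. \<integral>\<^sup>+z. h (\<lambda>k\<in>{..<p}. y k + mv p C \<mu> k + z k) \<partial>gauss {..<p})
      (\<lambda>k\<in>{..<p}. \<Sum>t<n. mv p C (X t) k) \<partial>PiM {..<n} (\<lambda>_. mvnormal p \<mu> S))"
    by (simp cong: restrict_cong)
  also have "\<dots> = (\<integral>\<^sup>+w. \<integral>\<^sup>+z. h (\<lambda>k\<in>{..<p}. real (Suc n) * mv p C \<mu> k + (sqrt n * w k + 1 * z k)) \<partial>gauss {..<p} \<partial>gauss {..<p})"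
    by (subst Suc.IH) (auto simp: algebra_simps cong: restrict_cong)
  also have "\<dots> = (\<integral>\<^sup>+w. \<integral>\<^sup>+z. (\<lambda>y. h (\<lambda>k\<in>{..<p}. real (Suc n) * mv p C \<mu> k + y k))
      (\<lambda>k\<in>{..<p}. sqrt n * w k + 1 * z k) \<partial>gauss {..<p} \<partial>gauss {..<p})"
    by (simp cong: restrict_cong)
  also have "\<dots> = (\<integral>\<^sup>+w. (\<lambda>y. h (\<lambda>k\<in>{..<p}. real (Suc n) * mv p C \<mu> k + y k))
      (\<lambda>k\<in>{..<p}. sqrt ((sqrt n)\<^sup>2 + 1\<^sup>2) * w k) \<partial>gauss {..<p})"
  proof (rule nn_integral_gauss_convolution)
    show "(\<lambda>y. h (\<lambda>k\<in>{..<p}. real (Suc n) * mv p C \<mu> k + y k)) \<in> borel_measurable B"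
      by measurable
  qed simp_all
  also have "\<dots> = (\<integral>\<^sup>+z. h (\<lambda>k\<in>{..<p}. real (Suc n) * mv p C \<mu> k + sqrt (Suc n) * z k) \<partial>gauss {..<p})"
  proof -
    have "sqrt ((sqrt n)\<^sup>2 + 1\<^sup>2) = sqrt (Suc n)" by (simp add: add.commute)
    show ?thesis unfolding \<open>sqrt ((sqrt n)\<^sup>2 + 1\<^sup>2) = sqrt (Suc n)\<close> by (simp cong: restrict_cong)
  qed
  finally show ?case .
qed

lemma distr_sample_mean:
  assumes n: "n > 0"
  shows "distr (PiM {..<n} (\<lambda>_. mvnormal p \<mu> S)) B (\<lambda>X. wh (sample_mean n X)) =
    distr (gauss {..<p}) B (\<lambda>z. \<lambda>k\<in>{..<p}. mv p C \<mu> k + z k / sqrt n)"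
proof (rule measure_eqI)
  have [measurable]: "(\<lambda>X. wh (sample_mean n X)) \<in> measurable (PiM {..<n} (\<lambda>_. mvnormal p \<mu> S)) B"
    unfolding mv_sample_mean by measurable
  fix A assume "A \<in> sets (distr (PiM {..<n} (\<lambda>_. mvnormal p \<mu> S)) B (\<lambda>X. wh (sample_mean n X)))"
  then have A [measurable]: "A \<in> sets B" by simp
  have "emeasure (distr (PiM {..<n} (\<lambda>_. mvnormal p \<mu> S)) B (\<lambda>X. wh (sample_mean n X))) A
    = (\<integral>\<^sup>+X. indicator A (wh (sample_mean n X)) \<partial>PiM {..<n} (\<lambda>_. mvnormal p \<mu> S))"
    by (simp add: nn_integral_distr flip: nn_integral_indicator)
  also have "\<dots> = (\<integral>\<^sup>+X. (\<lambda>y. indicator A (\<lambda>k\<in>{..<p}. y k / n)) (\<lambda>k\<in>{..<p}. \<Sum>t<n. mv p C (X t) k)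
      \<partial>PiM {..<n} (\<lambda>_. mvnormal p \<mu> S))"
    by (intro nn_integral_cong arg_cong[where f = "indicator A"]) (simp add: mv_sample_mean fun_eq_iff)
  also have "\<dots> = (\<integral>\<^sup>+z. (\<lambda>y. indicator A (\<lambda>k\<in>{..<p}. y k / n)) (\<lambda>k\<in>{..<p}. real n * mv p C \<mu> k + sqrt n * z k) \<partial>gauss {..<p})"
    by (rule nn_integral_sum_mvnormal) measurable
  also have "\<dots> = (\<integral>\<^sup>+z. indicator A (\<lambda>k\<in>{..<p}. mv p C \<mu> k + z k / sqrt n) \<partial>gauss {..<p})"
  proof -
    have "(real n * a + sqrt n * z) / n = a + z / sqrt n" for a z :: real
      using n by (simp add: field_simps)
    then show ?thesis by (simp cong: restrict_cong)
  qed
  also have "\<dots> = emeasure (distr (gauss {..<p}) B (\<lambda>z. \<lambda>k\<in>{..<p}. mv p C \<mu> k + z k / sqrt n)) A"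
    by (simp add: nn_integral_distr flip: nn_integral_indicator)
  finally show "emeasure (distr (PiM {..<n} (\<lambda>_. mvnormal p \<mu> S)) B (\<lambda>X. wh (sample_mean n X))) A
    = emeasure (distr (gauss {..<p}) B (\<lambda>z. \<lambda>k\<in>{..<p}. mv p C \<mu> k + z k / sqrt n)) A" .
qed simp

end

lemma whitening_exists:
  assumes "sym_pos_def p S"
  obtains C \<kappa> where "whitening p S C \<kappa>"
proof (rule complete_squares[OF sym_pos_def_minv[OF assms]])
  fix C \<kappa>
  assume *: "\<And>x y. qf p (minv p S) x y = (\<Sum>k<p. mv p C x k * mv p C y k)" "0 < \<kappa>"
    "\<And>h. h \<in> borel_measurable (PiM {..<p} (\<lambda>_. borel)) \<Longrightarrow>
      (\<integral>\<^sup>+x. h (restrict (mv p C x) {..<p}) \<partial>PiM {..<p} (\<lambda>_. lborel)) =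
        ennreal \<kappa> * (\<integral>\<^sup>+x. h x \<partial>PiM {..<p} (\<lambda>_. lborel))"
  have "whitening p S C \<kappa>"
    by (rule whitening.intro[OF assms *])
  then show ?thesis by (rule that)
qed

section \<open>Reduction to two independent Gaussian vectors\<close>

text \<open>Applied to indicators, \<open>nn_integral_gauss_convolution\<close> identifies two laws,
  and real integrals of \<open>h\<close> against equal laws agree. Boundedness supplies the
  integrability for Fubini.\<close>

lemma gauss_convolution:
  fixes h :: "('a \<Rightarrow> real) \<Rightarrow> real"
  assumes K: "finite K" and st: "0 \<le> s" "0 < t"
    and h [measurable]: "h \<in> borel_measurable (PiM K (\<lambda>_. borel))" and bound: "\<And>x. \<bar>h x\<bar> \<le> 1"
  shows "(\<integral>z. \<integral>w. h (\<lambda>k\<in>K. s * z k + t * w k) \<partial>gauss K \<partial>gauss K) =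
    (\<integral>z. h (\<lambda>k\<in>K. sqrt (s\<^sup>2 + t\<^sup>2) * z k) \<partial>gauss K)"
proof -
  interpret G: prob_space "gauss K" by (rule prob_space_gauss)
  interpret P: pair_prob_space "gauss K" "gauss K" by standard
  let ?B = "PiM K (\<lambda>_. borel :: real measure)"
  have "distr (gauss K \<Otimes>\<^sub>M gauss K) ?B (\<lambda>zw. \<lambda>k\<in>K. s * fst zw k + t * snd zw k) =
    distr (gauss K) ?B (\<lambda>z. \<lambda>k\<in>K. sqrt (s\<^sup>2 + t\<^sup>2) * z k)"
  proof (rule measure_eqI)
    fix A assume "A \<in> sets (distr (gauss K \<Otimes>\<^sub>M gauss K) ?B (\<lambda>zw. \<lambda>k\<in>K. s * fst zw k + t * snd zw k))"
    then have [measurable]: "A \<in> sets ?B" by simp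
    have "emeasure (distr (gauss K \<Otimes>\<^sub>M gauss K) ?B (\<lambda>zw. \<lambda>k\<in>K. s * fst zw k + t * snd zw k)) A =
      (\<integral>\<^sup>+zw. indicator A (\<lambda>k\<in>K. s * fst zw k + t * snd zw k) \<partial>(gauss K \<Otimes>\<^sub>M gauss K))"
      by (simp add: nn_integral_distr flip: nn_integral_indicator)
    also have "\<dots> = (\<integral>\<^sup>+z. \<integral>\<^sup>+w. indicator A (\<lambda>k\<in>K. s * z k + t * w k) \<partial>gauss K \<partial>gauss K)"
      by (subst G.nn_integral_fst[symmetric]) auto
    also have "\<dots> = (\<integral>\<^sup>+z. indicator A (\<lambda>k\<in>K. sqrt (s\<^sup>2 + t\<^sup>2) * z k) \<partial>gauss K)"
      by (rule nn_integral_gauss_convolution[OF K st]) simp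
    also have "\<dots> = emeasure (distr (gauss K) ?B (\<lambda>z. \<lambda>k\<in>K. sqrt (s\<^sup>2 + t\<^sup>2) * z k)) A"
      by (simp add: nn_integral_distr flip: nn_integral_indicator)
    finally show "emeasure (distr (gauss K \<Otimes>\<^sub>M gauss K) ?B (\<lambda>zw. \<lambda>k\<in>K. s * fst zw k + t * snd zw k)) A =
      emeasure (distr (gauss K) ?B (\<lambda>z. \<lambda>k\<in>K. sqrt (s\<^sup>2 + t\<^sup>2) * z k)) A" .
  qed simp
  then have "(\<integral>zw. h (\<lambda>k\<in>K. s * fst zw k + t * snd zw k) \<partial>(gauss K \<Otimes>\<^sub>M gauss K)) =
    (\<integral>z. h (\<lambda>k\<in>K. sqrt (s\<^sup>2 + t\<^sup>2) * z k) \<partial>gauss K)"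
    by (subst (1 2) integral_distr[OF _ h, symmetric]) auto
  also have "(\<integral>zw. h (\<lambda>k\<in>K. s * fst zw k + t * snd zw k) \<partial>(gauss K \<Otimes>\<^sub>M gauss K)) =
    (\<integral>z. \<integral>w. h (\<lambda>k\<in>K. s * z k + t * w k) \<partial>gauss K \<partial>gauss K)"
    using bound by (subst P.integral_fst'[symmetric]) (auto intro!: P.integrable_const_bound[where B = 1])
  finally show ?thesis .
qed

lemma (in prob_space) abs_integral_le_1:
  fixes h :: "'a \<Rightarrow> real"
  assumes "\<And>x. \<bar>h x\<bar> \<le> 1"
  shows "\<bar>\<integral>x. h x \<partial>M\<bar> \<le> 1"
proof (cases "integrable M h")
  case True
  have "\<bar>\<integral>x. h x \<partial>M\<bar> \<le> (\<integral>x. \<bar>h x\<bar> \<partial>M)"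
    by (rule integral_abs_bound)
  also have "\<dots> \<le> (\<integral>x. 1 \<partial>M)"
    using True assms by (intro integral_mono) auto
  finally show ?thesis by (simp add: prob_space)
next
  \<comment> \<open>A function that is not integrable has Bochner integral 0.\<close>
  case False
  then show ?thesis by (simp add: not_integrable_integral_eq)
qed

lemma integral_eq_of_distr_eq:
  fixes h :: "'a \<Rightarrow> real"
  assumes "distr M N f = distr M' N g" "f \<in> measurable M N" "g \<in> measurable M' N" "h \<in> borel_measurable N"
  shows "(\<integral>x. h (f x) \<partial>M) = (\<integral>x. h (g x) \<partial>M')"
  using assms by (metis integral_distr)

context whitening
begin

lemma measurable_wh_sample_mean:
  "(\<lambda>X. wh (sample_mean n X)) \<in> measurable (PiM {..<n} (\<lambda>_. mvnormal p \<mu> S)) B"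
  unfolding mv_sample_mean[abs_def] by measurable

text \<open>From the inside out, each of the four integrations becomes a standard Gaussian one.
  After a reordering, the prior and the sampling noise of the same class are adjacent and merge by
  the convolution lemma into variance \<open>1 / \<nu> i + 1 / n i\<close>.\<close>

lemma E_mu_S_eq_gauss:
  fixes G :: "(nat \<Rightarrow> real) \<Rightarrow> (nat \<Rightarrow> real) \<Rightarrow> real"
  assumes pos: "0 < n 0" "0 < n 1" "0 < \<nu> 0" "0 < \<nu> 1"
    and G [measurable]: "case_prod G \<in> borel_measurable (B \<Otimes>\<^sub>M B)"
    and bound: "\<And>x y. \<bar>G x y\<bar> \<le> 1"
  shows "E_mu_S p S n \<nu> m (\<lambda>mu0 mu1 X0 X1. G (wh (sample_mean (n 0) X0)) (wh (sample_mean (n 1) X1))) =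
    (\<integral>w. G (\<lambda>k\<in>{..<p}. mv p C (m 0) k + sqrt (1 / \<nu> 0 + 1 / n 0) * fst w k)
            (\<lambda>k\<in>{..<p}. mv p C (m 1) k + sqrt (1 / \<nu> 1 + 1 / n 1) * snd w k)
      \<partial>(gauss {..<p} \<Otimes>\<^sub>M gauss {..<p}))"
proof -
  let ?g = "gauss {..<p}"
  interpret g: prob_space ?g by (rule prob_space_gauss)
  interpret P: pair_prob_space ?g ?g by standard
  have sq: "sqrt (1 / \<nu> 0 + 1 / n 0) = sqrt ((1 / sqrt (\<nu> 0))\<^sup>2 + (1 / sqrt (n 0))\<^sup>2)"
    "sqrt (1 / \<nu> 1 + 1 / n 1) = sqrt ((1 / sqrt (\<nu> 1))\<^sup>2 + (1 / sqrt (n 1))\<^sup>2)"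
    using pos by (simp_all add: power_divide)
  have prior: "(\<integral>\<mu>. h (wh \<mu>) \<partial>mvnormal p (m i) (scale_mat (1 / \<nu> i) S)) =
      (\<integral>u. h (\<lambda>k\<in>{..<p}. mv p C (m i) k + 1 / sqrt (\<nu> i) * u k) \<partial>?g)"
    if "h \<in> borel_measurable B" "0 < \<nu> i" for h :: "_ \<Rightarrow> real" and i
    using integral_eq_of_distr_eq[OF distr_mvnormal[of "1 / \<nu> i" "m i"], of h] that
    by (simp add: real_sqrt_divide)
  have sample: "(\<integral>X. h (wh (sample_mean N X)) \<partial>PiM {..<N} (\<lambda>_. mvnormal p \<mu> S)) =
      (\<integral>z. h (\<lambda>k\<in>{..<p}. wh \<mu> k + 1 / sqrt N * z k) \<partial>?g)"
    if "h \<in> borel_measurable B" "0 < N" for h :: "_ \<Rightarrow> real" and N \<mu>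
    using integral_eq_of_distr_eq[OF distr_sample_mean[OF that(2)] measurable_wh_sample_mean _ that(1), of \<mu>]
    by (simp cong: restrict_cong)
  \<comment> \<open>In \<open>Q1 y x\<close>, \<open>y\<close> is the whitened mean of class 1 and
    \<open>x\<close> the whitened sample mean of class 0. In \<open>Q2 x y\<close> both arguments
    are whitened class means, and \<open>Q3 x\<close> retains only that of class 0. Depending on
    whitened vectors alone, they can be integrated against image laws.\<close>
  define Q1 where "Q1 y x = (\<integral>z. G x (\<lambda>k\<in>{..<p}. y k + 1 / sqrt (n 1) * z k) \<partial>?g)" for y x
  define Q2 where "Q2 x y = (\<integral>z. Q1 y (\<lambda>k\<in>{..<p}. x k + 1 / sqrt (n 0) * z k) \<partial>?g)" for x y
  define Q3 where "Q3 x = (\<integral>u. Q2 x (\<lambda>k\<in>{..<p}. mv p C (m 1) k + 1 / sqrt (\<nu> 1) * u k) \<partial>?g)" for x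
  have Q1 [measurable]: "case_prod Q1 \<in> borel_measurable (B \<Otimes>\<^sub>M B)"
    unfolding Q1_def by measurable
  have Q2 [measurable]: "case_prod Q2 \<in> borel_measurable (B \<Otimes>\<^sub>M B)"
    unfolding Q2_def by measurable
  have Q3 [measurable]: "Q3 \<in> borel_measurable B"
    unfolding Q3_def by measurable
  have wh_space: "wh x \<in> space B" for x by (simp add: space_PiM)
  have Q1_bound: "\<bar>Q1 y x\<bar> \<le> 1" for x y
    unfolding Q1_def by (rule g.abs_integral_le_1) (rule bound)
  have "E_mu_S p S n \<nu> m (\<lambda>mu0 mu1 X0 X1. G (wh (sample_mean (n 0) X0)) (wh (sample_mean (n 1) X1))) =
    (\<integral>mu0. \<integral>mu1. \<integral>X0. Q1 (wh mu1) (wh (sample_mean (n 0) X0)) \<partial>PiM {..<n 0} (\<lambda>_. mvnormal p mu0 S)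
      \<partial>mvnormal p (m 1) (scale_mat (1 / \<nu> 1) S) \<partial>mvnormal p (m 0) (scale_mat (1 / \<nu> 0) S))"
    unfolding E_mu_S_def Q1_def
    by (intro Bochner_Integration.integral_cong refl sample pos(2) measurable_Pair_compose_split[OF G] measurable_const wh_space measurable_ident_sets)
  also have "\<dots> = (\<integral>mu0. \<integral>mu1. Q2 (wh mu0) (wh mu1)
      \<partial>mvnormal p (m 1) (scale_mat (1 / \<nu> 1) S) \<partial>mvnormal p (m 0) (scale_mat (1 / \<nu> 0) S))"
    unfolding Q2_def
    by (intro Bochner_Integration.integral_cong refl sample pos(1) measurable_Pair_compose_split[OF Q1] measurable_const wh_space measurable_ident_sets)
  also have "\<dots> = (\<integral>mu0. Q3 (wh mu0) \<partial>mvnormal p (m 0) (scale_mat (1 / \<nu> 0) S))"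
    unfolding Q3_def
    by (intro Bochner_Integration.integral_cong refl prior pos(4) measurable_Pair_compose_split[OF Q2] measurable_const wh_space measurable_ident_sets)
  also have "\<dots> = (\<integral>u. Q3 (\<lambda>k\<in>{..<p}. mv p C (m 0) k + 1 / sqrt (\<nu> 0) * u k) \<partial>?g)"
    by (intro prior pos Q3)
  also have "\<dots> = (\<integral>u. \<integral>v. \<integral>z. Q1 (\<lambda>k\<in>{..<p}. mv p C (m 1) k + 1 / sqrt (\<nu> 1) * v k)
      (\<lambda>k\<in>{..<p}. mv p C (m 0) k + (1 / sqrt (\<nu> 0) * u k + 1 / sqrt (n 0) * z k)) \<partial>?g \<partial>?g \<partial>?g)"
    by (simp add: Q3_def Q2_def add.assoc cong: restrict_cong)
  \<comment> \<open>The prior noise \<open>v\<close> of class 1 and the sampling noise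
    \<open>z\<close> of class 0 are exchanged, so that \<open>u\<close> and \<open>z\<close>, both
    noise of class 0, become adjacent.\<close>
  also have "\<dots> = (\<integral>u. \<integral>z. \<integral>v. Q1 (\<lambda>k\<in>{..<p}. mv p C (m 1) k + 1 / sqrt (\<nu> 1) * v k)
      (\<lambda>k\<in>{..<p}. mv p C (m 0) k + (1 / sqrt (\<nu> 0) * u k + 1 / sqrt (n 0) * z k)) \<partial>?g \<partial>?g \<partial>?g)"
    using Q1_bound
    by (intro Bochner_Integration.integral_cong refl P.Fubini_integral P.integrable_const_bound[where B = 1]) auto
  \<comment> \<open>The two noise terms of class 1 merge; the step after this one does the same for
    class 0.\<close>
  also have "\<dots> = (\<integral>u. \<integral>z. \<integral>w. G (\<lambda>k\<in>{..<p}. mv p C (m 0) k + (1 / sqrt (\<nu> 0) * u k + 1 / sqrt (n 0) * z k))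
      (\<lambda>k\<in>{..<p}. mv p C (m 1) k + sqrt (1 / \<nu> 1 + 1 / n 1) * w k) \<partial>?g \<partial>?g \<partial>?g)"
  proof (rule Bochner_Integration.integral_cong[OF refl], rule Bochner_Integration.integral_cong[OF refl])
    fix u z :: "nat \<Rightarrow> real"
    let ?x = "\<lambda>k\<in>{..<p}. mv p C (m 0) k + (1 / sqrt (\<nu> 0) * u k + 1 / sqrt (n 0) * z k)"
    let ?h = "\<lambda>y. G ?x (\<lambda>k\<in>{..<p}. mv p C (m 1) k + y k)"
    have x: "?x \<in> space B" by (simp add: space_PiM)
    have "(\<lambda>y. G ?x y) \<in> borel_measurable B"
      by (intro measurable_Pair_compose_split[OF G] measurable_const x measurable_ident_sets refl)
    then have h: "?h \<in> borel_measurable B"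
      by (rule measurable_compose[rotated]) measurable
    have "(\<integral>v. Q1 (\<lambda>k\<in>{..<p}. mv p C (m 1) k + 1 / sqrt (\<nu> 1) * v k) ?x \<partial>?g)
      = (\<integral>v. \<integral>z. ?h (\<lambda>k\<in>{..<p}. 1 / sqrt (\<nu> 1) * v k + 1 / sqrt (n 1) * z k) \<partial>?g \<partial>?g)"
      by (simp add: Q1_def add.assoc cong: restrict_cong)
    also have "\<dots> = (\<integral>w. ?h (\<lambda>k\<in>{..<p}. sqrt (1 / \<nu> 1 + 1 / n 1) * w k) \<partial>?g)"
      unfolding sq by (rule gauss_convolution[OF finite_lessThan _ _ h bound]) (use pos in auto)
    finally show "(\<integral>v. Q1 (\<lambda>k\<in>{..<p}. mv p C (m 1) k + 1 / sqrt (\<nu> 1) * v k) ?x \<partial>?g)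
      = (\<integral>w. G ?x (\<lambda>k\<in>{..<p}. mv p C (m 1) k + sqrt (1 / \<nu> 1 + 1 / n 1) * w k) \<partial>?g)"
      by (simp cong: restrict_cong)
  qed
  also have "\<dots> = (\<integral>v. \<integral>w. G (\<lambda>k\<in>{..<p}. mv p C (m 0) k + sqrt (1 / \<nu> 0 + 1 / n 0) * v k)
      (\<lambda>k\<in>{..<p}. mv p C (m 1) k + sqrt (1 / \<nu> 1 + 1 / n 1) * w k) \<partial>?g \<partial>?g)"
  proof -
    let ?h = "\<lambda>x. \<integral>w. G (\<lambda>k\<in>{..<p}. mv p C (m 0) k + x k)
      (\<lambda>k\<in>{..<p}. mv p C (m 1) k + sqrt (1 / \<nu> 1 + 1 / n 1) * w k) \<partial>?g"
    have h: "?h \<in> borel_measurable B"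
      by measurable
    have "(\<integral>u. \<integral>z. ?h (\<lambda>k\<in>{..<p}. 1 / sqrt (\<nu> 0) * u k + 1 / sqrt (n 0) * z k) \<partial>?g \<partial>?g)
      = (\<integral>v. ?h (\<lambda>k\<in>{..<p}. sqrt (1 / \<nu> 0 + 1 / n 0) * v k) \<partial>?g)"
      unfolding sq(1) by (rule gauss_convolution[OF finite_lessThan _ _ h])
        (use pos bound in \<open>auto intro: g.abs_integral_le_1\<close>)
    then show ?thesis by (simp cong: restrict_cong)
  qed
  also have "\<dots> = (\<integral>w. G (\<lambda>k\<in>{..<p}. mv p C (m 0) k + sqrt (1 / \<nu> 0 + 1 / n 0) * fst w k)
            (\<lambda>k\<in>{..<p}. mv p C (m 1) k + sqrt (1 / \<nu> 1 + 1 / n 1) * snd w k) \<partial>(?g \<Otimes>\<^sub>M ?g))"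
    using bound by (subst P.integral_fst'[symmetric]) (auto intro!: P.integrable_const_bound[where B = 1])
  finally show ?thesis .
qed

end

section \<open>Convergence in probability and second moments\<close>

text \<open>Convergence in probability of random variables that live on different spaces \<open>M p\<close> is convergence
  along this filter on \<open>nat \<times> 'a\<close>, which makes the continuous mapping theorem available through the
  usual limit rules.\<close>

definition prob_filter :: "(nat \<Rightarrow> 'a measure) \<Rightarrow> (nat \<times> 'a) filter" where
  "prob_filter M = Abs_filter (\<lambda>P. \<exists>A. (\<forall>p. A p \<in> sets (M p)) \<and> (\<lambda>p. emeasure (M p) (A p)) \<longlonglongrightarrow> 0 \<and>
    (\<forall>p. \<forall>\<omega>\<in>space (M p) - A p. P (p, \<omega>)))"

text \<open>The filter property to check is closure under conjunction: the union of two exceptional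
  sets still has vanishing measure, by subadditivity.\<close>

lemma eventually_prob_filter:
  "eventually P (prob_filter M) \<longleftrightarrow>
    (\<exists>A. (\<forall>p. A p \<in> sets (M p)) \<and> (\<lambda>p. emeasure (M p) (A p)) \<longlonglongrightarrow> 0 \<and>
    (\<forall>p. \<forall>\<omega>\<in>space (M p) - A p. P (p, \<omega>)))"
  unfolding prob_filter_def
proof (rule eventually_Abs_filter, rule is_filter.intro, goal_cases)
  case 1
  show ?case by (intro exI[of _ "\<lambda>_. {}"]) auto
next
  case (2 P Q)
  from 2(1) obtain A where A: "\<forall>p. A p \<in> sets (M p)" "(\<lambda>p. emeasure (M p) (A p)) \<longlonglongrightarrow> 0"
      "\<forall>p. \<forall>\<omega>\<in>space (M p) - A p. P (p, \<omega>)"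
    by (elim exE conjE) (rule that)
  from 2(2) obtain B where B: "\<forall>p. B p \<in> sets (M p)" "(\<lambda>p. emeasure (M p) (B p)) \<longlonglongrightarrow> 0"
      "\<forall>p. \<forall>\<omega>\<in>space (M p) - B p. Q (p, \<omega>)"
    by (elim exE conjE) (rule that)
  have "(\<lambda>p. emeasure (M p) (A p) + emeasure (M p) (B p)) \<longlonglongrightarrow> 0 + 0"
    by (intro tendsto_add A B)
  then have lim: "(\<lambda>p. emeasure (M p) (A p) + emeasure (M p) (B p)) \<longlonglongrightarrow> 0"
    by simp
  have "(\<lambda>p. emeasure (M p) (A p \<union> B p)) \<longlonglongrightarrow> 0"
    by (rule tendsto_sandwich[OF _ _ tendsto_const[of 0] lim])
       (use A(1) B(1) in \<open>auto intro!: always_eventually emeasure_subadditive\<close>)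
  moreover have "\<forall>p. A p \<union> B p \<in> sets (M p)"
    using A(1) B(1) by simp
  moreover have "\<forall>p. \<forall>\<omega>\<in>space (M p) - (A p \<union> B p). P (p, \<omega>) \<and> Q (p, \<omega>)"
    using A(3) B(3) by simp
  ultimately show ?case
    by (intro exI[of _ "\<lambda>p. A p \<union> B p"]) simp
next
  case (3 P Q)
  from 3(2) show ?case
  proof (elim exE conjE, intro exI conjI)
    fix A assume "\<forall>p. \<forall>\<omega>\<in>space (M p) - A p. P (p, \<omega>)"
    then show "\<forall>p. \<forall>\<omega>\<in>space (M p) - A p. Q (p, \<omega>)" using 3(1) by simp
  qed assumption
qed

lemma filterlim_fst_prob_filter: "filterlim fst sequentially (prob_filter M)"
  unfolding filterlim_iff
proof (intro allI impI)
  fix P :: "nat \<Rightarrow> bool"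
  assume P: "eventually P sequentially"
  \<comment> \<open>Indices where \<open>P\<close> fails get the whole space as exceptional set;
    this is harmless because only the limit of the measures counts.\<close>
  define A where "A p = (if P p then {} else space (M p))" for p
  have "eventually (\<lambda>p. emeasure (M p) (A p) = 0) sequentially"
    using P by eventually_elim (simp add: A_def)
  then have "(\<lambda>p. emeasure (M p) (A p)) \<longlonglongrightarrow> 0"
    by (rule tendsto_eventually)
  then show "eventually (\<lambda>x. P (fst x)) (prob_filter M)"
    unfolding eventually_prob_filter by (intro exI[of _ A]) (auto simp: A_def)
qed

lemma tendsto_prob_filter_const:
  "X \<longlonglongrightarrow> l \<Longrightarrow> ((\<lambda>x. X (fst x)) \<longlongrightarrow> l) (prob_filter M)"
  by (rule filterlim_compose[OF _ filterlim_fst_prob_filter])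

text \<open>Chebyshev's inequality: the set where |X| is at least \<open>e\<close> has measure at
  most the second moment divided by e^2.\<close>

lemma tendsto_prob_filter_second_moment:
  fixes X :: "nat \<Rightarrow> 'a \<Rightarrow> real"
  assumes int: "\<And>p. integrable (M p) (\<lambda>\<omega>. (X p \<omega>)\<^sup>2)"
    and lim: "(\<lambda>p. \<integral>\<omega>. (X p \<omega>)\<^sup>2 \<partial>M p) \<longlonglongrightarrow> 0"
  shows "((\<lambda>x. X (fst x) (snd x)) \<longlongrightarrow> 0) (prob_filter M)"
proof (rule tendstoI)
  fix e :: real assume e: "e > 0"
  define A where "A p = {\<omega> \<in> space (M p). (X p \<omega>)\<^sup>2 \<ge> e\<^sup>2}" for p
  have A: "A p \<in> sets (M p)" for p
    using borel_measurable_integrable[OF int[of p]] unfolding A_def by measurable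
  have "(\<lambda>p. ennreal (1 / e\<^sup>2 * (\<integral>\<omega>. (X p \<omega>)\<^sup>2 \<partial>M p))) \<longlonglongrightarrow> ennreal (1 / e\<^sup>2 * 0)"
    by (intro tendsto_ennrealI tendsto_mult tendsto_const lim)
  then have lim: "(\<lambda>p. ennreal (1 / e\<^sup>2 * (\<integral>\<omega>. (X p \<omega>)\<^sup>2 \<partial>M p))) \<longlonglongrightarrow> 0"
    by simp
  have "emeasure (M p) (A p) \<le> ennreal (1 / e\<^sup>2 * (\<integral>\<omega>. (X p \<omega>)\<^sup>2 \<partial>M p))" for p
    using integral_Markov_inequality[OF int, of p "e\<^sup>2"] e by (simp add: A_def)
  then have "(\<lambda>p. emeasure (M p) (A p)) \<longlonglongrightarrow> 0"
    by (intro tendsto_sandwich[OF _ _ tendsto_const[of 0] lim] always_eventually allI) auto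
  moreover have "dist (X p \<omega>) 0 < e" if "\<omega> \<in> space (M p) - A p" for p \<omega>
  proof -
    have "\<bar>X p \<omega>\<bar>\<^sup>2 < e\<^sup>2" using that by (auto simp: A_def not_le)
    then have "\<bar>X p \<omega>\<bar> < e" by (rule power_less_imp_less_base) (use e in simp)
    then show ?thesis by (simp add: dist_real_def)
  qed
  ultimately show "eventually (\<lambda>x. dist (X (fst x) (snd x)) 0 < e) (prob_filter M)"
    unfolding eventually_prob_filter using A by (intro exI[of _ A]) auto
qed

text \<open>Bounded convergence over varying spaces: off the exceptional set the integrand is within
  e/2 of \<open>l\<close>, and on it the distance is at most K + |l|, weighted by a vanishing
  measure.\<close>

lemma tendsto_integral_prob_filter:
  fixes f :: "nat \<Rightarrow> 'a \<Rightarrow> real"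
  assumes prob: "\<And>p. prob_space (M p)"
    and lim: "((\<lambda>x. f (fst x) (snd x)) \<longlongrightarrow> l) (prob_filter M)"
    and meas: "\<And>p. f p \<in> borel_measurable (M p)"
    and bound: "\<And>p \<omega>. \<bar>f p \<omega>\<bar> \<le> K"
  shows "(\<lambda>p. \<integral>\<omega>. f p \<omega> \<partial>M p) \<longlonglongrightarrow> l"
proof (rule tendstoI)
  fix e :: real assume e: "e > 0"
  have K: "0 \<le> K" using bound[of 0 undefined] by (rule order_trans[OF abs_ge_zero])
  from tendstoD[OF lim, of "e / 2"] e obtain A where
    A: "\<And>p. A p \<in> sets (M p)" "(\<lambda>p. emeasure (M p) (A p)) \<longlonglongrightarrow> 0"
      "\<And>p \<omega>. \<omega> \<in> space (M p) - A p \<Longrightarrow> dist (f p \<omega>) l < e / 2"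
    unfolding eventually_prob_filter by auto
  have "(\<lambda>p. enn2real (emeasure (M p) (A p))) \<longlonglongrightarrow> enn2real 0"
    by (rule tendsto_enn2real) (use A in auto)
  then have "(\<lambda>p. measure (M p) (A p)) \<longlonglongrightarrow> 0"
    by (simp add: measure_def)
  then have "(\<lambda>p. e / 2 + (K + \<bar>l\<bar>) * measure (M p) (A p)) \<longlonglongrightarrow> e / 2 + (K + \<bar>l\<bar>) * 0"
    by (intro tendsto_intros)
  then have "eventually (\<lambda>p. e / 2 + (K + \<bar>l\<bar>) * measure (M p) (A p) < e) sequentially"
    by (rule order_tendstoD(2)) (use e in simp)
  then show "eventually (\<lambda>p. dist (\<integral>\<omega>. f p \<omega> \<partial>M p) l < e) sequentially"
  proof eventually_elim
    case (elim p)
    interpret prob_space "M p" by (rule prob)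
    have int: "integrable (M p) (f p)"
      by (rule integrable_const_bound[where B = K]) (use meas bound in auto)
    have int_ind: "integrable (M p) (indicator (A p) :: _ \<Rightarrow> real)"
      using A(1) by (simp add: emeasure_eq_measure)
    have "\<bar>(\<integral>\<omega>. f p \<omega> \<partial>M p) - l\<bar> = \<bar>\<integral>\<omega>. (f p \<omega> - l) \<partial>M p\<bar>"
      using int by (simp add: prob_space)
    also have "\<dots> \<le> (\<integral>\<omega>. \<bar>f p \<omega> - l\<bar> \<partial>M p)"
      by (rule integral_abs_bound)
    also have "\<dots> \<le> (\<integral>\<omega>. e / 2 + (K + \<bar>l\<bar>) * indicator (A p) \<omega> \<partial>M p)"
    proof (intro integral_mono)
      fix \<omega> assume \<omega>: "\<omega> \<in> space (M p)"
      show "\<bar>f p \<omega> - l\<bar> \<le> e / 2 + (K + \<bar>l\<bar>) * indicator (A p) \<omega>"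
      proof (cases "\<omega> \<in> A p")
        case True
        then show ?thesis using bound[of p \<omega>] e by simp
      next
        case False
        then show ?thesis using A(3)[of \<omega> p] \<omega> by (simp add: dist_real_def)
      qed
    qed (use int int_ind in auto)
    also have "\<dots> = e / 2 + (K + \<bar>l\<bar>) * measure (M p) (A p)"
      using int_ind A(1)[of p] by (simp add: prob_space)
    also note elim
    finally show ?case by (simp add: dist_real_def)
  qed
qed

section \<open>Second moments of linear forms, squared norms and inner products of Gaussian
  vectors\<close>

lemma integrable_std_normal_power: "integrable std_normal_distribution (\<lambda>x. x ^ k)"
  using integrable_std_normal_moment[of k] by (simp add: integrable_density)

lemma integral_std_normal_power:
  "(\<integral>x. x \<partial>std_normal_distribution) = 0" "(\<integral>x. x ^ 2 \<partial>std_normal_distribution) = 1"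
  "(\<integral>x. x ^ 4 \<partial>std_normal_distribution) = 3"
  using integral_std_normal_moment_odd[of 0] integral_std_normal_moment_even[of 1] integral_std_normal_moment_even[of 2]
  by (simp_all add: integral_density fact_numeral)

lemma gauss_pair_moment:
  fixes g h :: "real \<Rightarrow> real"
  assumes K: "finite K" and kl: "k \<in> K" "l \<in> K" "k \<noteq> l"
    and gh: "integrable std_normal_distribution g" "integrable std_normal_distribution h"
  shows "integrable (gauss K) (\<lambda>z. g (z k) * h (z l))"
    and "(\<integral>z. g (z k) * h (z l) \<partial>gauss K) =
      (\<integral>x. g x \<partial>std_normal_distribution) * (\<integral>x. h x \<partial>std_normal_distribution)"
proof -
  interpret N: prob_space std_normal_distribution by (rule prob_space_std_normal)
  interpret P: product_sigma_finite "\<lambda>_ :: 'a. std_normal_distribution" by standard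
  \<comment> \<open>All factors other than those at \<open>k\<close> and \<open>l\<close> are the
    constant 1, so the product formula over \<open>K\<close> reduces to two integrals.\<close>
  define f where "f i = (if i = k then g else if i = l then h else (\<lambda>_. 1))" for i
  have f: "integrable std_normal_distribution (f i)" for i
    using gh by (simp add: f_def)
  have K_eq: "K = insert k (insert l (K - {k, l}))" using kl by auto
  have prod: "(\<Prod>i\<in>K. F i) = F k * F l" if "\<And>i. i \<notin> {k, l} \<Longrightarrow> F i = 1" for F :: "'a \<Rightarrow> real"
    using K kl that by (subst K_eq) (simp add: prod.neutral)
  have "(\<Prod>i\<in>K. f i (z i)) = g (z k) * h (z l)" for z
    using kl by (subst prod) (auto simp: f_def)
  moreover have "(\<Prod>i\<in>K. \<integral>x. f i x \<partial>std_normal_distribution) =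
      (\<integral>x. g x \<partial>std_normal_distribution) * (\<integral>x. h x \<partial>std_normal_distribution)"
    using kl N.prob_space by (subst prod) (auto simp: f_def)
  ultimately show "integrable (gauss K) (\<lambda>z. g (z k) * h (z l))"
    and "(\<integral>z. g (z k) * h (z l) \<partial>gauss K) =
      (\<integral>x. g x \<partial>std_normal_distribution) * (\<integral>x. h x \<partial>std_normal_distribution)"
    using P.product_integrable_prod[of K f] P.product_integral_prod[of K f] K f by simp_all
qed

lemma gauss_single_moment:
  fixes g :: "real \<Rightarrow> real"
  assumes k: "k \<in> K" and g: "integrable std_normal_distribution g"
  shows "integrable (gauss K) (\<lambda>z. g (z k))"
    and "(\<integral>z. g (z k) \<partial>gauss K) = (\<integral>x. g x \<partial>std_normal_distribution)"
proof -
  have d: "distr (gauss K) std_normal_distribution (\<lambda>z. z k) = std_normal_distribution"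
    by (rule distr_PiM_component) (use k in \<open>auto intro: prob_space_std_normal\<close>)
  have m: "(\<lambda>z. z k) \<in> measurable (gauss K) std_normal_distribution"
    using k by measurable
  show "integrable (gauss K) (\<lambda>z. g (z k))"
    using integrable_distr[OF m, of g] g unfolding d by blast
  show "(\<integral>z. g (z k) \<partial>gauss K) = (\<integral>x. g x \<partial>std_normal_distribution)"
    using integral_distr[OF m borel_measurable_integrable[OF g]] unfolding d by simp
qed

text \<open>The off-diagonal terms vanish by independence and centering. It is applied with g x = x
  for linear forms and with g x = x^2 - 1 for the squared norm.\<close>

lemma gauss_sum_second_moment:
  fixes a :: "'a \<Rightarrow> real" and g :: "real \<Rightarrow> real"
  assumes K: "finite K"
    and g: "integrable std_normal_distribution g" "integrable std_normal_distribution (\<lambda>x. (g x)\<^sup>2)"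
    and centered: "(\<integral>x. g x \<partial>std_normal_distribution) = 0"
  shows "integrable (gauss K) (\<lambda>z. (\<Sum>k\<in>K. a k * g (z k))\<^sup>2)"
    and "(\<integral>z. (\<Sum>k\<in>K. a k * g (z k))\<^sup>2 \<partial>gauss K) =
      (\<Sum>k\<in>K. (a k)\<^sup>2) * (\<integral>x. (g x)\<^sup>2 \<partial>std_normal_distribution)"
proof -
  have expand: "(\<Sum>k\<in>K. a k * g (z k))\<^sup>2 = (\<Sum>k\<in>K. \<Sum>l\<in>K. a k * a l * (g (z k) * g (z l)))" for z
    by (simp add: power2_eq_square sum_product mult_ac)
  have int: "integrable (gauss K) (\<lambda>z. a k * a l * (g (z k) * g (z l)))" if "k \<in> K" "l \<in> K" for k l
    using gauss_pair_moment(1)[OF K that _ g(1) g(1)] gauss_single_moment(1)[OF that(1) g(2)]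
    by (cases "k = l") (auto simp: power2_eq_square)
  have val: "(\<integral>z. a k * a l * (g (z k) * g (z l)) \<partial>gauss K) =
      (if k = l then (a k)\<^sup>2 * (\<integral>x. (g x)\<^sup>2 \<partial>std_normal_distribution) else 0)" if "k \<in> K" "l \<in> K" for k l
    using gauss_pair_moment(2)[OF K that _ g(1) g(1)] gauss_single_moment(2)[OF that(1) g(2)] centered
    by (auto simp: power2_eq_square)
  show "integrable (gauss K) (\<lambda>z. (\<Sum>k\<in>K. a k * g (z k))\<^sup>2)"
    unfolding expand by (intro Bochner_Integration.integrable_sum int)
  have "(\<integral>z. (\<Sum>k\<in>K. a k * g (z k))\<^sup>2 \<partial>gauss K) =
      (\<Sum>k\<in>K. \<Sum>l\<in>K. \<integral>z. a k * a l * (g (z k) * g (z l)) \<partial>gauss K)"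
  proof -
    have "(\<integral>z. (\<Sum>k\<in>K. \<Sum>l\<in>K. a k * a l * (g (z k) * g (z l))) \<partial>gauss K) =
        (\<Sum>k\<in>K. \<integral>z. (\<Sum>l\<in>K. a k * a l * (g (z k) * g (z l))) \<partial>gauss K)"
      by (rule Bochner_Integration.integral_sum) (rule Bochner_Integration.integrable_sum[OF int])
    also have "\<dots> = (\<Sum>k\<in>K. \<Sum>l\<in>K. \<integral>z. a k * a l * (g (z k) * g (z l)) \<partial>gauss K)"
      by (rule sum.cong[OF refl], rule Bochner_Integration.integral_sum, rule int)
    finally show ?thesis unfolding expand .
  qed
  also have "\<dots> = (\<Sum>k\<in>K. \<Sum>l\<in>K. if k = l then (a k)\<^sup>2 * (\<integral>x. (g x)\<^sup>2 \<partial>std_normal_distribution) else 0)"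
    by (intro sum.cong refl val)
  also have "\<dots> = (\<Sum>k\<in>K. (a k)\<^sup>2 * (\<integral>x. (g x)\<^sup>2 \<partial>std_normal_distribution))"
    using K by simp
  finally show "(\<integral>z. (\<Sum>k\<in>K. a k * g (z k))\<^sup>2 \<partial>gauss K) =
      (\<Sum>k\<in>K. (a k)\<^sup>2) * (\<integral>x. (g x)\<^sup>2 \<partial>std_normal_distribution)"
    by (simp add: sum_distrib_right)
qed

lemma gauss_linear_second_moment:
  fixes a :: "'a \<Rightarrow> real"
  assumes K: "finite K"
  shows "integrable (gauss K) (\<lambda>z. (\<Sum>k\<in>K. a k * z k)\<^sup>2)"
    and "(\<integral>z. (\<Sum>k\<in>K. a k * z k)\<^sup>2 \<partial>gauss K) = (\<Sum>k\<in>K. (a k)\<^sup>2)"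
  using gauss_sum_second_moment[OF K, of "\<lambda>x. x" a] integrable_std_normal_power[of 1]
    integrable_std_normal_power[of 2]
  by (simp_all add: integral_std_normal_power)

lemma gauss_norm_variance:
  assumes K: "finite K"
  shows "integrable (gauss K) (\<lambda>z. ((\<Sum>k\<in>K. (z k)\<^sup>2) - card K)\<^sup>2)"
    and "(\<integral>z. ((\<Sum>k\<in>K. (z k)\<^sup>2) - card K)\<^sup>2 \<partial>gauss K) = 2 * card K"
proof -
  interpret N: prob_space std_normal_distribution by (rule prob_space_std_normal)
  note int = integrable_std_normal_power[of 2] integrable_std_normal_power[of 4]
  \<comment> \<open>With second moment 1 and fourth moment 3 this integrates to 3 - 2 + 1 =
    2.\<close>
  have sq: "(x\<^sup>2 - 1)\<^sup>2 = x ^ 4 - 2 * x\<^sup>2 + 1" for x :: real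
    by (simp add: power2_eq_square power4_eq_xxxx algebra_simps)
  have "integrable std_normal_distribution (\<lambda>x. x\<^sup>2 - 1)"
    "integrable std_normal_distribution (\<lambda>x. (x\<^sup>2 - 1)\<^sup>2)"
    "(\<integral>x. x\<^sup>2 - 1 \<partial>std_normal_distribution) = 0"
    "(\<integral>x. (x\<^sup>2 - 1)\<^sup>2 \<partial>std_normal_distribution) = 2"
    unfolding sq using int N.prob_space by (simp_all add: integral_std_normal_power)
  from gauss_sum_second_moment[OF K this(1-3), of "\<lambda>_. 1"] this(4)
  show "integrable (gauss K) (\<lambda>z. ((\<Sum>k\<in>K. (z k)\<^sup>2) - card K)\<^sup>2)"
    and "(\<integral>z. ((\<Sum>k\<in>K. (z k)\<^sup>2) - card K)\<^sup>2 \<partial>gauss K) = 2 * card K"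
    by (simp_all add: sum_subtractf)
qed

text \<open>For fixed first vector z the inner product is a linear form in the second one with
  second moment |z|^2, and |z|^2 has mean \<open>card K\<close>.\<close>

lemma gauss_inner_second_moment:
  assumes K: "finite K"
  shows "integrable (gauss K \<Otimes>\<^sub>M gauss K) (\<lambda>w. (\<Sum>k\<in>K. fst w k * snd w k)\<^sup>2)"
    and "(\<integral>w. (\<Sum>k\<in>K. fst w k * snd w k)\<^sup>2 \<partial>(gauss K \<Otimes>\<^sub>M gauss K)) = card K"
proof -
  interpret G: prob_space "gauss K" by (rule prob_space_gauss)
  interpret P: pair_prob_space "gauss K" "gauss K" by standard
  have sq: "integrable (gauss K) (\<lambda>z. (z k)\<^sup>2)" "(\<integral>z. (z k)\<^sup>2 \<partial>gauss K) = 1" if "k \<in> K" for k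
    using gauss_single_moment[OF that integrable_std_normal_power[of 2]] by (simp_all add: integral_std_normal_power)
  show int: "integrable (gauss K \<Otimes>\<^sub>M gauss K) (\<lambda>w. (\<Sum>k\<in>K. fst w k * snd w k)\<^sup>2)"
  proof (rule P.Fubini_integrable)
    show "integrable (gauss K) (\<lambda>z. \<integral>w. norm ((\<Sum>k\<in>K. fst (z, w) k * snd (z, w) k)\<^sup>2) \<partial>gauss K)"
      by (simp add: gauss_linear_second_moment[OF K] sq)
    show "AE z in gauss K. integrable (gauss K) (\<lambda>w. (\<Sum>k\<in>K. fst (z, w) k * snd (z, w) k)\<^sup>2)"
      by (simp add: gauss_linear_second_moment[OF K])
  qed measurable
  have "(\<integral>w. (\<Sum>k\<in>K. fst w k * snd w k)\<^sup>2 \<partial>(gauss K \<Otimes>\<^sub>M gauss K)) =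
    (\<integral>z. \<integral>w. (\<Sum>k\<in>K. z k * w k)\<^sup>2 \<partial>gauss K \<partial>gauss K)"
    by (subst P.integral_fst'[OF int, symmetric]) simp
  also have "\<dots> = card K"
    by (simp add: gauss_linear_second_moment[OF K] sq)
  finally show "(\<integral>w. (\<Sum>k\<in>K. fst w k * snd w k)\<^sup>2 \<partial>(gauss K \<Otimes>\<^sub>M gauss K)) = card K" .
qed

section \<open>The error estimator in whitened coordinates\<close>

lemma Phi_eq_cdf: "Phi = cdf std_normal_distribution"
  by (simp add: Phi_def cdf_def fun_eq_iff)

text \<open>A distribution function is continuous wherever its law has no atom, and a law with a
  density has none.\<close>

lemma continuous_Phi: "isCont Phi x"
proof -
  interpret real_distribution std_normal_distribution
    by (simp add: real_distribution_def real_distribution_axioms_def prob_space_std_normal)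
  have "measure std_normal_distribution {x} = 0"
    by (simp add: measure_def emeasure_density)
  then show ?thesis
    unfolding Phi_eq_cdf isCont_cdf .
qed

lemma Phi_nonneg: "0 \<le> Phi x" and Phi_le_1: "Phi x \<le> 1"
  using prob_space.prob_le_1[OF prob_space_std_normal] by (auto simp: Phi_def)

lemma borel_measurable_Phi [measurable]: "Phi \<in> borel_measurable borel"
  by (intro borel_measurable_continuous_onI continuous_at_imp_continuous_on) (auto intro: continuous_Phi)

lemma mv_add: "mv p C (\<lambda>k. x k + y k) i = mv p C x i + mv p C y i"
  by (simp add: mv_def algebra_simps sum.distrib)

lemma mv_scale: "mv p C (\<lambda>k. a * x k) i = a * mv p C x i"
  by (simp add: mv_def algebra_simps sum_distrib_left)

lemma mv_divide: "mv p C (\<lambda>k. x k / a) i = mv p C x i / a"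
  by (simp add: mv_def sum_divide_distrib)

text \<open>The estimator of class \<open>i\<close> in whitened coordinates: \<open>a\<close>, \<open>x\<close>, \<open>y\<close> are the whitened prior mean
  and sample means.\<close>

definition white_err :: "nat \<Rightarrow> real \<Rightarrow> nat \<Rightarrow> real \<Rightarrow> real \<Rightarrow> (nat \<Rightarrow> real) \<Rightarrow> (nat \<Rightarrow> real) \<Rightarrow> (nat \<Rightarrow> real) \<Rightarrow> real" where
  "white_err p c i N \<nu> a x y = Phi ((-1) ^ i *
    ((- (\<Sum>k<p. ((N * (if i = 0 then x else y) k + \<nu> * a k) / (N + \<nu>) - (x k + y k) / 2) * (x k - y k)) + c)
      / sqrt (\<Sum>k<p. (x k - y k)\<^sup>2)) * sqrt ((N + \<nu>) / (N + \<nu> + 1)))"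

lemma (in whitening) bayes_err_i_eq_white_err:
  "bayes_err_i p (minv p S) c i N \<nu> m x y = white_err p c i (real N) \<nu> (mv p C m) (wh x) (wh y)"
proof -
  let ?xi = "if i = 0 then x else y"
  have "qf p (minv p S) (\<lambda>k. (real N * ?xi k + \<nu> * m k) / (real N + \<nu>) - (x k + y k) / 2) (\<lambda>k. x k - y k) =
    (\<Sum>k<p. ((real N * (if i = 0 then wh x else wh y) k + \<nu> * mv p C m k) / (real N + \<nu>)
      - (wh x k + wh y k) / 2) * (wh x k - wh y k))"
    unfolding qf_minv mv_diff mv_divide mv_add mv_scale by (intro sum.cong refl) auto
  moreover have "qf p (minv p S) (\<lambda>k. x k - y k) (\<lambda>k. x k - y k) = (\<Sum>k<p. (wh x k - wh y k)\<^sup>2)"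
    by (simp add: qf_minv mv_diff power2_eq_square)
  ultimately show ?thesis
    by (simp add: bayes_err_i_def white_err_def Let_def)
qed

lemma measurable_white_err [measurable]:
  "(\<lambda>(x, y). white_err p c i N \<nu> a x y) \<in>
    borel_measurable (PiM {..<p} (\<lambda>_. borel) \<Otimes>\<^sub>M PiM {..<p} (\<lambda>_. borel))"
  unfolding white_err_def by (cases "i = 0") simp_all

text \<open>This isolates the five inner products whose limits are found separately. The midpoint
  term becomes a difference of squared norms because (x + y).(x - y) = |x|^2 - |y|^2.\<close>

lemma white_err_expand:
  "white_err p c i N \<nu> a x y =
    (let xx = (\<Sum>k<p. x k * x k); xy = (\<Sum>k<p. x k * y k); yy = (\<Sum>k<p. y k * y k);
         ax = (\<Sum>k<p. a k * x k); ay = (\<Sum>k<p. a k * y k) in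
    Phi ((-1) ^ i * ((- (N / (N + \<nu>) * (if i = 0 then xx - xy else xy - yy) + \<nu> / (N + \<nu>) * (ax - ay)
      - (xx - yy) / 2) + c) / sqrt (xx - 2 * xy + yy)) * sqrt ((N + \<nu>) / (N + \<nu> + 1))))"
proof -
  have "(\<Sum>k<p. ((N * (if i = 0 then x else y) k + \<nu> * a k) / (N + \<nu>) - (x k + y k) / 2) * (x k - y k)) =
    (\<Sum>k<p. N / (N + \<nu>) * (if i = 0 then x k * x k - x k * y k else x k * y k - y k * y k)
      + \<nu> / (N + \<nu>) * (a k * x k - a k * y k) - (x k * x k - y k * y k) / 2)"
    by (intro sum.cong refl) (simp add: algebra_simps add_divide_distrib diff_divide_distrib)
  moreover have "(\<Sum>k<p. (x k - y k)\<^sup>2) = (\<Sum>k<p. x k * x k - 2 * (x k * y k) + y k * y k)"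
    by (intro sum.cong refl) (simp add: algebra_simps power2_eq_square)
  ultimately show ?thesis
    by (simp add: white_err_def Let_def sum.distrib sum_subtractf flip: sum_distrib_left sum_divide_distrib)
qed

section \<open>Limits along the Gaussian representation\<close>

abbreviation gauss2 :: "nat \<Rightarrow> ((nat \<Rightarrow> real) \<times> (nat \<Rightarrow> real)) measure" where
  "gauss2 p \<equiv> gauss {..<p} \<Otimes>\<^sub>M gauss {..<p}"

abbreviation coord :: "nat \<Rightarrow> 'a \<times> 'a \<Rightarrow> 'a" where
  "coord i w \<equiv> (if i = 0 then fst w else snd w)"

lemma prob_space_gauss2: "prob_space (gauss2 p)"
  by (intro prob_space_pair prob_space_gauss)

lemma integral_gauss2_coord:
  fixes f :: "(nat \<Rightarrow> real) \<Rightarrow> real"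
  assumes f: "integrable (gauss {..<p}) f"
  shows "integrable (gauss2 p) (\<lambda>w. f (coord i w))"
    and "(\<integral>w. f (coord i w) \<partial>gauss2 p) = (\<integral>z. f z \<partial>gauss {..<p})"
proof -
  let ?g = "gauss {..<p}"
  interpret g: prob_space ?g by (rule prob_space_gauss)
  interpret P: pair_prob_space ?g ?g by standard
  have fst: "distr (gauss2 p) ?g fst = ?g" by (rule g.distr_pair_fst)
  have snd: "distr (gauss2 p) ?g snd = ?g"
  proof -
    have "distr (gauss2 p) ?g snd = distr (distr (gauss2 p) (gauss2 p) (\<lambda>(x, y). (y, x))) ?g snd"
      by (subst P.distr_pair_swap[symmetric]) (rule refl)
    also have "\<dots> = distr (gauss2 p) ?g fst"
      by (subst distr_distr) (auto simp: comp_def case_prod_beta)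
    finally show ?thesis using fst by simp
  qed
  have d: "distr (gauss2 p) ?g (coord i) = ?g"
    using fst snd by (cases "i = 0") simp_all
  have m: "coord i \<in> measurable (gauss2 p) ?g"
    by (cases "i = 0") simp_all
  show "integrable (gauss2 p) (\<lambda>w. f (coord i w))"
    using integrable_distr[OF m, of f] f unfolding d by blast
  show "(\<integral>w. f (coord i w) \<partial>gauss2 p) = (\<integral>z. f z \<partial>?g)"
    using integral_distr[OF m borel_measurable_integrable[OF f]] unfolding d by simp
qed

text \<open>The second moment is s^2 |a|^2, a null sequence times a convergent one.\<close>

lemma tendsto_gauss2_linear:
  assumes a: "(\<lambda>p. \<Sum>k<p. a p k * a p k) \<longlonglongrightarrow> A" and s: "s \<longlonglongrightarrow> 0"
  shows "((\<lambda>x. s (fst x) * (\<Sum>k<fst x. a (fst x) k * coord i (snd x) k)) \<longlongrightarrow> 0) (prob_filter gauss2)"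
proof (rule tendsto_prob_filter_second_moment)
  note lin = gauss_linear_second_moment[OF finite_lessThan]
  show "integrable (gauss2 p) (\<lambda>w. (s p * (\<Sum>k<p. a p k * coord i w k))\<^sup>2)" for p
    unfolding power_mult_distrib by (intro integrable_mult_right integral_gauss2_coord(1)[OF lin(1)])
  have "(\<integral>w. (s p * (\<Sum>k<p. a p k * coord i w k))\<^sup>2 \<partial>gauss2 p) = (s p)\<^sup>2 * (\<Sum>k<p. a p k * a p k)" for p
    unfolding power_mult_distrib using integral_gauss2_coord(2)[OF lin(1)[of p "a p"], of i] lin(2)[of p "a p"]
    by (simp add: power2_eq_square)
  moreover have "(\<lambda>p. (s p)\<^sup>2 * (\<Sum>k<p. a p k * a p k)) \<longlonglongrightarrow> 0\<^sup>2 * A"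
    by (intro tendsto_intros a s)
  ultimately show "(\<lambda>p. \<integral>w. (s p * (\<Sum>k<p. a p k * coord i w k))\<^sup>2 \<partial>gauss2 p) \<longlonglongrightarrow> 0"
    by simp
qed

text \<open>The mean p s^2 tends to \<open>T\<close>, and the variance 2 p s^4 = 2 (p s^2) s^2 tends
  to 0.\<close>

lemma tendsto_gauss2_norm:
  assumes T: "(\<lambda>p. real p * (s p)\<^sup>2) \<longlonglongrightarrow> T" and s: "s \<longlonglongrightarrow> 0"
  shows "((\<lambda>x. (s (fst x))\<^sup>2 * (\<Sum>k<fst x. (coord i (snd x) k)\<^sup>2)) \<longlongrightarrow> T) (prob_filter gauss2)"
proof -
  note var = gauss_norm_variance[OF finite_lessThan]
  have "((\<lambda>x. (s (fst x))\<^sup>2 * ((\<Sum>k<fst x. (coord i (snd x) k)\<^sup>2) - real (card {..<fst x}))) \<longlongrightarrow> 0)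
    (prob_filter gauss2)"
  proof (rule tendsto_prob_filter_second_moment)
    show "integrable (gauss2 p) (\<lambda>w. ((s p)\<^sup>2 * ((\<Sum>k<p. (coord i w k)\<^sup>2) - real (card {..<p})))\<^sup>2)" for p
      unfolding power_mult_distrib by (intro integrable_mult_right integral_gauss2_coord(1)[OF var(1)])
    have "(\<integral>w. ((s p)\<^sup>2 * ((\<Sum>k<p. (coord i w k)\<^sup>2) - real (card {..<p})))\<^sup>2 \<partial>gauss2 p) =
        2 * (real p * (s p)\<^sup>2) * (s p)\<^sup>2" for p
      unfolding power_mult_distrib using integral_gauss2_coord(2)[OF var(1)[of p], of i] var(2)[of p]
      by (simp add: power2_eq_square)
    moreover have "(\<lambda>p. 2 * (real p * (s p)\<^sup>2) * (s p)\<^sup>2) \<longlonglongrightarrow> 2 * T * 0\<^sup>2"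
      by (intro tendsto_intros T s)
    ultimately show "(\<lambda>p. \<integral>w. ((s p)\<^sup>2 * ((\<Sum>k<p. (coord i w k)\<^sup>2) - real (card {..<p})))\<^sup>2 \<partial>gauss2 p) \<longlonglongrightarrow> 0"
      by simp
  qed
  from tendsto_add[OF this tendsto_prob_filter_const[OF T]]
  show ?thesis by (simp add: algebra_simps)
qed

text \<open>The second moment is (p s^2) t^2, a convergent sequence times a null one.\<close>

lemma tendsto_gauss2_inner:
  assumes T: "(\<lambda>p. real p * (s p)\<^sup>2) \<longlonglongrightarrow> T" and t: "t \<longlonglongrightarrow> 0"
  shows "((\<lambda>x. s (fst x) * t (fst x) * (\<Sum>k<fst x. fst (snd x) k * snd (snd x) k)) \<longlongrightarrow> 0) (prob_filter gauss2)"
proof (rule tendsto_prob_filter_second_moment)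
  note moment = gauss_inner_second_moment[OF finite_lessThan]
  show "integrable (gauss2 p) (\<lambda>w. (s p * t p * (\<Sum>k<p. fst w k * snd w k))\<^sup>2)" for p
    unfolding power_mult_distrib by (intro integrable_mult_right moment(1))
  have "(\<integral>w. (s p * t p * (\<Sum>k<p. fst w k * snd w k))\<^sup>2 \<partial>gauss2 p) = real p * (s p)\<^sup>2 * (t p)\<^sup>2" for p
    unfolding power_mult_distrib[of "s p * t p"] using moment(2)[of p]
    by (simp add: power_mult_distrib)
  moreover have "(\<lambda>p. real p * (s p)\<^sup>2 * (t p)\<^sup>2) \<longlonglongrightarrow> T * 0\<^sup>2"
    by (intro tendsto_intros T t)
  ultimately show "(\<lambda>p. \<integral>w. (s p * t p * (\<Sum>k<p. fst w k * snd w k))\<^sup>2 \<partial>gauss2 p) \<longlonglongrightarrow> 0"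
    by simp
qed

text \<open>Continuous mapping. \<open>w\<close> and \<open>v\<close> are the limiting weights of
  the sample mean and of the prior mean in the posterior mean, and \<open>pos\<close> keeps the
  division continuous at the limit.\<close>

lemma tendsto_white_err:
  assumes lim: "((\<lambda>x. \<Sum>k<P x. X x k * X x k) \<longlongrightarrow> xx) Fl" "((\<lambda>x. \<Sum>k<P x. X x k * Y x k) \<longlongrightarrow> xy) Fl"
    "((\<lambda>x. \<Sum>k<P x. Y x k * Y x k) \<longlongrightarrow> yy) Fl" "((\<lambda>x. \<Sum>k<P x. A x k * X x k) \<longlongrightarrow> ax) Fl"
    "((\<lambda>x. \<Sum>k<P x. A x k * Y x k) \<longlongrightarrow> ay) Fl"
    and coeff: "((\<lambda>x. N x / (N x + \<nu> x)) \<longlongrightarrow> w) Fl" "((\<lambda>x. \<nu> x / (N x + \<nu> x)) \<longlongrightarrow> v) Fl"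
    "((\<lambda>x. (N x + \<nu> x) / (N x + \<nu> x + 1)) \<longlongrightarrow> 1) Fl"
    and pos: "xx - 2 * xy + yy > 0"
  shows "((\<lambda>x. white_err (P x) c i (N x) (\<nu> x) (A x) (X x) (Y x)) \<longlongrightarrow>
    Phi ((-1) ^ i * ((- (w * (if i = 0 then xx - xy else xy - yy) + v * (ax - ay) - (xx - yy) / 2) + c)
      / sqrt (xx - 2 * xy + yy)))) Fl"
proof -
  have "((\<lambda>x. white_err (P x) c i (N x) (\<nu> x) (A x) (X x) (Y x)) \<longlongrightarrow>
    Phi ((-1) ^ i * ((- (w * (if i = 0 then xx - xy else xy - yy) + v * (ax - ay) - (xx - yy) / 2) + c)
      / sqrt (xx - 2 * xy + yy)) * sqrt 1)) Fl"
    unfolding white_err_expand Let_def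
    by (cases "i = 0"; simp only: if_True if_False)
       (intro isCont_tendsto_compose[OF continuous_Phi] tendsto_mult tendsto_divide tendsto_diff tendsto_add
         tendsto_minus tendsto_real_sqrt tendsto_const lim coeff; use pos in simp)+
  then show ?thesis by simp
qed

lemma white_err_bounds: "0 \<le> white_err p c i N \<nu> a x y" "white_err p c i N \<nu> a x y \<le> 1"
  by (simp_all add: white_err_def Phi_nonneg Phi_le_1)

text \<open>Below, \<open>s p\<close> is the unconditional standard deviation of each whitened coordinate of the sample mean:
  prior variance \<open>1 / \<nu> p\<close> plus sampling variance \<open>1 / N p\<close>.\<close>

lemma prior_sample_limits:
  fixes N :: "nat \<Rightarrow> nat" and \<nu> :: "nat \<Rightarrow> real"
  assumes N: "filterlim N at_top sequentially" and \<nu>: "filterlim \<nu> at_top sequentially" "\<And>p. \<nu> p > 0"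
    and J: "(\<lambda>p. real p / real (N p)) \<longlonglongrightarrow> J"
    and \<gamma>: "(\<lambda>p. \<nu> p / real (N p)) \<longlonglongrightarrow> \<gamma>" "\<gamma> > 0"
  defines "s \<equiv> \<lambda>p. sqrt (1 / \<nu> p + 1 / real (N p))"
  shows "s \<longlonglongrightarrow> 0"
    and "(\<lambda>p. real p * (s p)\<^sup>2) \<longlonglongrightarrow> J + J / \<gamma>"
    and "(\<lambda>p. real (N p) / (real (N p) + \<nu> p)) \<longlonglongrightarrow> 1 / (1 + \<gamma>)"
    and "(\<lambda>p. \<nu> p / (real (N p) + \<nu> p)) \<longlonglongrightarrow> \<gamma> / (1 + \<gamma>)"
    and "(\<lambda>p. (real (N p) + \<nu> p) / (real (N p) + \<nu> p + 1)) \<longlonglongrightarrow> 1"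
proof -
  have N': "filterlim (\<lambda>p. real (N p)) at_top sequentially"
    by (rule filterlim_compose[OF filterlim_real_sequentially N])
  have pos: "eventually (\<lambda>p. N p > 0) sequentially"
    by (rule eventually_compose_filterlim[OF eventually_gt_at_top N])
  have "(\<lambda>p. 1 / \<nu> p) \<longlonglongrightarrow> 0" "(\<lambda>p. 1 / real (N p)) \<longlonglongrightarrow> 0"
    by (intro tendsto_divide_0[OF tendsto_const] filterlim_at_top_imp_at_infinity N' \<nu>)+
  from tendsto_real_sqrt[OF tendsto_add[OF this]] show "s \<longlonglongrightarrow> 0"
    by (simp add: s_def)
  \<comment> \<open>The ratio p/\<nu> is written as (p/N)/(\<nu>/N), a quotient of two sequences
    with known limits.\<close>
  have "(\<lambda>p. real p / real (N p) + (real p / real (N p)) / (\<nu> p / real (N p))) \<longlonglongrightarrow> J + J / \<gamma>"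
    using \<gamma>(2) by (intro tendsto_intros J \<gamma>) auto
  moreover have "eventually (\<lambda>p. real p / real (N p) + (real p / real (N p)) / (\<nu> p / real (N p)) =
      real p * (s p)\<^sup>2) sequentially"
    using pos
  proof eventually_elim
    case (elim p)
    have "(s p)\<^sup>2 = 1 / \<nu> p + 1 / real (N p)" using \<nu>(2)[of p] by (simp add: s_def less_imp_le)
    then show ?case using elim by (simp add: algebra_simps)
  qed
  ultimately show "(\<lambda>p. real p * (s p)\<^sup>2) \<longlonglongrightarrow> J + J / \<gamma>"
    by (rule Lim_transform_eventually)
  have "(\<lambda>p. 1 / (1 + \<nu> p / real (N p))) \<longlonglongrightarrow> 1 / (1 + \<gamma>)"
    using \<gamma>(2) by (intro tendsto_intros \<gamma>) auto
  moreover have "eventually (\<lambda>p. 1 / (1 + \<nu> p / real (N p)) = real (N p) / (real (N p) + \<nu> p)) sequentially"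
    using pos
  proof eventually_elim
    case (elim p)
    then have "1 + \<nu> p / real (N p) = (real (N p) + \<nu> p) / real (N p)" by (simp add: add_divide_distrib)
    then show ?case by simp
  qed
  ultimately show *: "(\<lambda>p. real (N p) / (real (N p) + \<nu> p)) \<longlonglongrightarrow> 1 / (1 + \<gamma>)"
    by (rule Lim_transform_eventually)
  have sum_pos: "real (N p) + \<nu> p > 0" for p
    using \<nu>(2)[of p] by (simp add: add_nonneg_pos)
  have eq: "\<nu> p / (real (N p) + \<nu> p) = 1 - real (N p) / (real (N p) + \<nu> p)" for p
    using sum_pos[of p] by (simp add: field_simps)
  have "(\<lambda>p. 1 - real (N p) / (real (N p) + \<nu> p)) \<longlonglongrightarrow> 1 - 1 / (1 + \<gamma>)"
    by (intro tendsto_intros *)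
  then show "(\<lambda>p. \<nu> p / (real (N p) + \<nu> p)) \<longlonglongrightarrow> \<gamma> / (1 + \<gamma>)"
    using \<gamma>(2) unfolding eq by (simp add: field_simps)
  have eq': "(real (N p) + \<nu> p) / (real (N p) + \<nu> p + 1) = 1 - 1 / (real (N p) + \<nu> p + 1)" for p
    using sum_pos[of p] by (simp add: field_simps)
  have "filterlim (\<lambda>p. real (N p) + \<nu> p + 1) at_top sequentially"
    by (rule filterlim_at_top_mono[OF N']) (use \<nu>(2) in \<open>auto intro!: always_eventually simp: add_nonneg_nonneg less_imp_le\<close>)
  from tendsto_diff[OF tendsto_const tendsto_divide_0[OF tendsto_const filterlim_at_top_imp_at_infinity[OF this]], of 1 1]
  show "(\<lambda>p. (real (N p) + \<nu> p) / (real (N p) + \<nu> p + 1)) \<longlonglongrightarrow> 1"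
    unfolding eq' by simp
qed

theorem theorem5:
  fixes alpha0 :: real
    and Sg :: "nat \<Rightarrow> nat \<Rightarrow> nat \<Rightarrow> real"
    and n :: "nat \<Rightarrow> nat \<Rightarrow> nat"
    and nu :: "nat \<Rightarrow> nat \<Rightarrow> real"
    and m :: "nat \<Rightarrow> nat \<Rightarrow> nat \<Rightarrow> real"
    and J gamma :: "nat \<Rightarrow> real"
    and L :: "nat \<Rightarrow> nat \<Rightarrow> real"
    and Dbar :: real
  defines "c \<equiv> ln ((1 - alpha0) / alpha0)"
    and "alpha \<equiv> (\<lambda>i::nat. if i = 0 then alpha0 else 1 - alpha0)"
    and "Sinv \<equiv> (\<lambda>p. minv p (Sg p))"
    and "F \<equiv> Dbar + J 0 + J 1 + J 0 / gamma 0 + J 1 / gamma 1"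
    and "H \<equiv> (\<lambda>i::nat. if i = 0
               then (Dbar + J 1 - J 0 + J 0 / gamma 0 + J 1 / gamma 1) / 2
               else - (Dbar + J 0 - J 1 + J 0 / gamma 0 + J 1 / gamma 1) / 2)"
    and "epsB \<equiv> (\<lambda>p i (X0 :: nat \<Rightarrow> nat \<Rightarrow> real) (X1 :: nat \<Rightarrow> nat \<Rightarrow> real).
               bayes_err_i p (minv p (Sg p)) (ln ((1 - alpha0) / alpha0)) i (n p i) (nu p i) (m p i)
                 (sample_mean (n p 0) X0) (sample_mean (n p 1) X1))"
  assumes alpha0: "0 < alpha0" "alpha0 < 1"
    and Sg_spd: "\<And>p. sym_pos_def p (Sg p)"
    and nu_pos: "\<And>p i. i < 2 \<Longrightarrow> nu p i > 0"
    and n_lim: "\<And>i. i < 2 \<Longrightarrow> filterlim (\<lambda>p. n p i) at_top sequentially"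
    and nu_lim: "\<And>i. i < 2 \<Longrightarrow> filterlim (\<lambda>p. nu p i) at_top sequentially"
    and J_lim: "\<And>i. i < 2 \<Longrightarrow> (\<lambda>p. real p / real (n p i)) \<longlonglongrightarrow> J i"
    and J_nonneg: "\<And>i. i < 2 \<Longrightarrow> J i \<ge> 0"
    and gamma_lim: "\<And>i. i < 2 \<Longrightarrow> (\<lambda>p. nu p i / real (n p i)) \<longlonglongrightarrow> gamma i"
    and gamma_pos: "\<And>i. i < 2 \<Longrightarrow> gamma i > 0"
    and m_lim: "\<And>i j. i < 2 \<Longrightarrow> j < 2 \<Longrightarrow>
                  (\<lambda>p. qf p (Sinv p) (m p i) (m p j)) \<longlonglongrightarrow> L i j"
    and Dbar_lim: "(\<lambda>p. qf p (Sinv p) (\<lambda>k. m p 0 k - m p 1 k) (\<lambda>k. m p 0 k - m p 1 k))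
                     \<longlonglongrightarrow> Dbar"
    and F_pos: "F > 0"
  shows "(\<forall>i<2. \<forall>j<2.
            (\<lambda>p. E_mu_S p (Sg p) (n p) (nu p) (m p)
                    (\<lambda>mu0 mu1 X0 X1. epsB p i X0 X1 * epsB p j X0 X1))
            \<longlonglongrightarrow> Phi ((-1) ^ i * ((- H i + c) / sqrt F)) * Phi ((-1) ^ j * ((- H j + c) / sqrt F)))
       \<and> (\<lambda>p. E_mu_S p (Sg p) (n p) (nu p) (m p)
               (\<lambda>mu0 mu1 X0 X1. (alpha 0 * epsB p 0 X0 X1 + alpha 1 * epsB p 1 X0 X1) ^ 2))
            \<longlonglongrightarrow> (alpha0 * Phi ((- H 0 + c) / sqrt F) + (1 - alpha0) * Phi ((H 1 - c) / sqrt F)) ^ 2"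
proof -
  have "\<forall>p. \<exists>C \<kappa>. whitening p (Sg p) C \<kappa>"
    using whitening_exists[OF Sg_spd] by blast
  \<comment> \<open>Choice fixes a whitening for all \<open>p\<close> at once, so that the locale
    can be interpreted with \<open>p\<close> as a parameter.\<close>
  then obtain C \<kappa> where "\<forall>p. whitening p (Sg p) (C p) (\<kappa> p)"
    unfolding choice_iff by blast
  then interpret whitening p "Sg p" "C p" "\<kappa> p" for p by blast
  define a where "a i p = mv p (C p) (m p i)" for i p
  define s where "s i p = sqrt (1 / nu p i + 1 / real (n p i))" for i p
  define X where "X i x = (\<lambda>k\<in>{..<fst x}. a i (fst x) k + s i (fst x) * coord i (snd x) k)"
    for i and x :: "nat \<times> (nat \<Rightarrow> real) \<times> (nat \<Rightarrow> real)"
  define T where "T i = J i + J i / gamma i" for i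
  let ?Fl = "prob_filter gauss2"
  note lims = prior_sample_limits[OF n_lim nu_lim nu_pos J_lim gamma_lim gamma_pos, folded s_def]
  have s: "s i \<longlonglongrightarrow> 0" and sT: "(\<lambda>p. real p * (s i p)\<^sup>2) \<longlonglongrightarrow> T i" if "i < 2" for i
    using lims(1,2)[of i] that by (simp_all add: s_def[abs_def] T_def)
  have aa: "(\<lambda>p. \<Sum>k<p. a i p k * a j p k) \<longlonglongrightarrow> L i j" if "i < 2" "j < 2" for i j
    using m_lim[OF that] by (simp add: Sinv_def qf_minv a_def)
  have sum_comm: "(\<Sum>k<p. a i p k * a j p k) = (\<Sum>k<p. a j p k * a i p k)" for i j p
    by (simp add: mult.commute)
  \<comment> \<open>\<open>L\<close> is known only through limits, so its symmetry comes from that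
    of the inner product and from uniqueness of limits.\<close>
  have L_sym: "L 1 0 = L 0 1"
  proof (rule LIMSEQ_unique)
    show "(\<lambda>p. \<Sum>k<p. a 1 p k * a 0 p k) \<longlonglongrightarrow> L 1 0" by (rule aa) auto
    show "(\<lambda>p. \<Sum>k<p. a 1 p k * a 0 p k) \<longlonglongrightarrow> L 0 1"
      unfolding sum_comm[of 1] by (rule aa) auto
  qed
  have Dbar: "Dbar = L 0 0 - 2 * L 0 1 + L 1 1"
  proof (rule LIMSEQ_unique[OF Dbar_lim])
    have "qf p (Sinv p) (\<lambda>k. m p 0 k - m p 1 k) (\<lambda>k. m p 0 k - m p 1 k) =
      (\<Sum>k<p. a 0 p k * a 0 p k) - 2 * (\<Sum>k<p. a 0 p k * a 1 p k) + (\<Sum>k<p. a 1 p k * a 1 p k)" for p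
      unfolding Sinv_def qf_minv mv_diff a_def
      by (simp add: algebra_simps sum.distrib sum_subtractf sum_distrib_left)
    moreover have "(\<lambda>p. (\<Sum>k<p. a 0 p k * a 0 p k) - 2 * (\<Sum>k<p. a 0 p k * a 1 p k) + (\<Sum>k<p. a 1 p k * a 1 p k))
      \<longlonglongrightarrow> L 0 0 - 2 * L 0 1 + L 1 1"
      by (intro tendsto_intros aa) auto
    ultimately show "(\<lambda>p. qf p (Sinv p) (\<lambda>k. m p 0 k - m p 1 k) (\<lambda>k. m p 0 k - m p 1 k))
      \<longlonglongrightarrow> L 0 0 - 2 * L 0 1 + L 1 1" by simp
  qed
  have lin: "((\<lambda>x. s j (fst x) * (\<Sum>k<fst x. a i (fst x) k * coord j (snd x) k)) \<longlongrightarrow> 0) ?Fl"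
    if "i < 2" "j < 2" for i j
    by (rule tendsto_gauss2_linear[OF aa s]) (use that in auto)
  have aX: "((\<lambda>x. \<Sum>k<fst x. a i (fst x) k * X j x k) \<longlongrightarrow> L i j) ?Fl" if "i < 2" "j < 2" for i j
  proof -
    have "(\<Sum>k<fst x. a i (fst x) k * X j x k) = (\<Sum>k<fst x. a i (fst x) k * a j (fst x) k)
      + s j (fst x) * (\<Sum>k<fst x. a i (fst x) k * coord j (snd x) k)" for x
      by (simp add: X_def algebra_simps sum.distrib sum_distrib_left)
    then show ?thesis
      using tendsto_add[OF tendsto_prob_filter_const[OF aa[OF that]] lin[OF that]] by simp
  qed
  have XX: "((\<lambda>x. \<Sum>k<fst x. X i x k * X i x k) \<longlongrightarrow> L i i + T i) ?Fl" if "i < 2" for i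
  proof -
    have "(\<Sum>k<fst x. X i x k * X i x k) = (\<Sum>k<fst x. a i (fst x) k * X i x k)
      + s i (fst x) * (\<Sum>k<fst x. a i (fst x) k * coord i (snd x) k)
      + (s i (fst x))\<^sup>2 * (\<Sum>k<fst x. (coord i (snd x) k)\<^sup>2)" for x
      by (simp add: X_def algebra_simps sum.distrib sum_distrib_left power2_eq_square)
    then show ?thesis
      using tendsto_add[OF tendsto_add[OF aX[OF that that] lin[OF that that]] tendsto_gauss2_norm[OF sT[OF that] s[OF that], of i]]
      by simp
  qed
  have XY: "((\<lambda>x. \<Sum>k<fst x. X 0 x k * X 1 x k) \<longlongrightarrow> L 0 1) ?Fl"
  proof -
    have "(\<Sum>k<fst x. X 0 x k * X 1 x k) = (\<Sum>k<fst x. a 0 (fst x) k * X 1 x k)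
      + s 0 (fst x) * (\<Sum>k<fst x. a 1 (fst x) k * coord 0 (snd x) k)
      + s 0 (fst x) * s 1 (fst x) * (\<Sum>k<fst x. fst (snd x) k * snd (snd x) k)" for x
      by (simp add: X_def algebra_simps sum.distrib sum_distrib_left)
    then show ?thesis
      using tendsto_add[OF tendsto_add[OF aX[of 0 1] lin[of 1 0]] tendsto_gauss2_inner[OF sT[of 0] s[of 1]]]
      by simp
  qed
  \<comment> \<open>The right-hand side is the limit in probability of the squared distance between
    the whitened sample means.\<close>
  have F: "F = (L 0 0 + T 0) - 2 * L 0 1 + (L 1 1 + T 1)"
    by (simp add: F_def Dbar T_def)
  define l where "l i = Phi ((-1) ^ i * ((- H i + c) / sqrt F))" for i
  define e where "e i x = white_err (fst x) c i (real (n (fst x) i)) (nu (fst x) i) (a i (fst x)) (X 0 x) (X 1 x)" for i x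
  have e_lim: "(e i \<longlongrightarrow> l i) ?Fl" if i: "i < 2" for i
  proof -
    have g: "gamma i > 0" by (rule gamma_pos[OF i])
    have "((\<lambda>x. e i x) \<longlongrightarrow>
      Phi ((-1) ^ i * ((- (1 / (1 + gamma i) * (if i = 0 then L 0 0 + T 0 - L 0 1 else L 0 1 - (L 1 1 + T 1))
        + gamma i / (1 + gamma i) * (L i 0 - L i 1) - (L 0 0 + T 0 - (L 1 1 + T 1)) / 2) + c)
        / sqrt (L 0 0 + T 0 - 2 * L 0 1 + (L 1 1 + T 1))))) ?Fl"
      unfolding e_def
      by (rule tendsto_white_err)
         (use i XX XY aX F F_pos in \<open>auto intro!: tendsto_prob_filter_const lims(3-5)\<close>)
    also have "1 / (1 + gamma i) * (if i = 0 then L 0 0 + T 0 - L 0 1 else L 0 1 - (L 1 1 + T 1))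
        + gamma i / (1 + gamma i) * (L i 0 - L i 1) - (L 0 0 + T 0 - (L 1 1 + T 1)) / 2 = H i"
    proof -
      have g1: "1 + gamma i \<noteq> 0" using g by simp
      \<comment> \<open>T_i = J_i (1 + \<gamma>_i)/\<gamma>_i, so the limiting weight of the sample
        mean leaves exactly J_i/\<gamma>_i.\<close>
      have TJ: "1 / (1 + gamma i) * T i = J i / gamma i"
        using g g1 by (simp add: T_def divide_simps) (simp add: algebra_simps)
      \<comment> \<open>The two weights sum to 1: the contribution \<open>d\<close> of the prior
        means is unaffected by them, and only the noise part \<open>t\<close> is scaled.\<close>
      have split: "1 / (1 + gamma i) * (d + t) + gamma i / (1 + gamma i) * d = d + 1 / (1 + gamma i) * t" for d t
        using g1 by (simp add: divide_simps) (simp add: algebra_simps)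
      define u where "u = 1 / (1 + gamma i) * (if i = 0 then L 0 0 + T 0 - L 0 1 else L 0 1 - (L 1 1 + T 1))"
      define w where "w = gamma i / (1 + gamma i) * (L i 0 - L i 1)"
      consider "i = 0" | "i = 1" using i by linarith
      then have "u + w - (L 0 0 + T 0 - (L 1 1 + T 1)) / 2 = H i"
      proof cases
        case 1
        have eq: "u + w = (L 0 0 - L 0 1) + J 0 / gamma 0"
          using split[of "L 0 0 - L 0 1" "T 0"] TJ 1 by (simp add: algebra_simps u_def w_def)
        show ?thesis unfolding eq using 1 by (simp add: H_def Dbar T_def field_simps)
      next
        case 2
        have eq: "u + w = (L 0 1 - L 1 1) - J 1 / gamma 1"
          using split[of "L 0 1 - L 1 1" "- T 1"] TJ 2 by (simp add: algebra_simps L_sym[simplified] u_def w_def)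
        show ?thesis unfolding eq using 2 by (simp add: H_def Dbar T_def field_simps)
      qed
      then show ?thesis unfolding u_def w_def .
    qed
    finally show ?thesis unfolding l_def F .
  qed
  \<comment> \<open>A general continuous \<Psi> covers both the products and the square of the total
    estimator. A bound on the unit square suffices because the estimators are values of
    \<open>Phi\<close>.\<close>
  have main: "(\<lambda>p. E_mu_S p (Sg p) (n p) (nu p) (m p) (\<lambda>mu0 mu1 X0 X1. \<Psi> (epsB p 0 X0 X1) (epsB p 1 X0 X1)))
      \<longlonglongrightarrow> \<Psi> (l 0) (l 1)"
    if cont: "continuous_on UNIV (case_prod \<Psi>)" and bound: "\<And>u v. 0 \<le> u \<Longrightarrow> u \<le> 1 \<Longrightarrow> 0 \<le> v \<Longrightarrow> v \<le> 1 \<Longrightarrow> \<bar>\<Psi> u v\<bar> \<le> 1"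
    for \<Psi> :: "real \<Rightarrow> real \<Rightarrow> real"
  proof -
    define G where "G p x y = \<Psi> (white_err p c 0 (real (n p 0)) (nu p 0) (a 0 p) x y)
      (white_err p c 1 (real (n p 1)) (nu p 1) (a 1 p) x y)" for p x y
    have [measurable]: "case_prod \<Psi> \<in> borel_measurable (borel \<Otimes>\<^sub>M borel)"
      using borel_measurable_continuous_onI[OF cont] by (simp add: borel_prod)
    have G [measurable]: "case_prod (G p) \<in> borel_measurable (PiM {..<p} (\<lambda>_. borel) \<Otimes>\<^sub>M PiM {..<p} (\<lambda>_. borel))" for p
      unfolding G_def by measurable
    have G_bound: "\<bar>G p x y\<bar> \<le> 1" for p x y
      unfolding G_def by (intro bound white_err_bounds)
    have "((\<lambda>x. case_prod \<Psi> (e 0 x, e 1 x)) \<longlongrightarrow> case_prod \<Psi> (l 0, l 1)) ?Fl"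
      using cont by (intro isCont_tendsto_compose[of _ "case_prod \<Psi>"] tendsto_Pair e_lim)
        (auto simp: continuous_on_eq_continuous_at)
    then have "((\<lambda>x. (\<lambda>p w. G p (X 0 (p, w)) (X 1 (p, w))) (fst x) (snd x)) \<longlongrightarrow> \<Psi> (l 0) (l 1)) ?Fl"
      by (simp add: G_def e_def)
    then have "(\<lambda>p. \<integral>w. G p (X 0 (p, w)) (X 1 (p, w)) \<partial>gauss2 p) \<longlonglongrightarrow> \<Psi> (l 0) (l 1)"
    proof (rule tendsto_integral_prob_filter[OF prob_space_gauss2])
      show "(\<lambda>w. G p (X 0 (p, w)) (X 1 (p, w))) \<in> borel_measurable (gauss2 p)" for p
        unfolding X_def by (rule measurable_Pair_compose_split[OF G]) (simp_all, measurable)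
      show "\<bar>G p (X 0 (p, w)) (X 1 (p, w))\<bar> \<le> 1" for p w by (rule G_bound)
    qed
    \<comment> \<open>The Gaussian representation needs nonempty samples, which are available for
      all large \<open>p\<close>.\<close>
    moreover have "eventually (\<lambda>p. n p 0 > 0 \<and> n p 1 > 0) sequentially"
      by (intro eventually_conj eventually_compose_filterlim[OF eventually_gt_at_top n_lim]) auto
    then have "eventually (\<lambda>p. (\<integral>w. G p (X 0 (p, w)) (X 1 (p, w)) \<partial>gauss2 p) =
      E_mu_S p (Sg p) (n p) (nu p) (m p) (\<lambda>mu0 mu1 X0 X1. \<Psi> (epsB p 0 X0 X1) (epsB p 1 X0 X1))) sequentially"
    proof eventually_elim
      case (elim p)
      have "E_mu_S p (Sg p) (n p) (nu p) (m p) (\<lambda>mu0 mu1 X0 X1. \<Psi> (epsB p 0 X0 X1) (epsB p 1 X0 X1)) =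
        E_mu_S p (Sg p) (n p) (nu p) (m p) (\<lambda>mu0 mu1 X0 X1.
          G p (restrict (mv p (C p) (sample_mean (n p 0) X0)) {..<p}) (restrict (mv p (C p) (sample_mean (n p 1) X1)) {..<p}))"
        by (simp add: epsB_def bayes_err_i_eq_white_err G_def a_def c_def)
      also have "\<dots> = (\<integral>w. G p (X 0 (p, w)) (X 1 (p, w)) \<partial>gauss2 p)"
        using elim by (subst E_mu_S_eq_gauss[OF _ _ _ _ G G_bound]) (auto simp: nu_pos X_def a_def s_def)
      finally show ?case by simp
    qed
    ultimately show ?thesis by (rule Lim_transform_eventually)
  qed
  show ?thesis
  proof (intro conjI allI impI)
    fix i j :: nat assume ij: "i < 2" "j < 2"
    define \<Psi> where "\<Psi> u v = (if i = 0 then u else v) * (if j = 0 then u else v)" for u v :: real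
    have "(\<lambda>p. E_mu_S p (Sg p) (n p) (nu p) (m p) (\<lambda>mu0 mu1 X0 X1. \<Psi> (epsB p 0 X0 X1) (epsB p 1 X0 X1)))
      \<longlonglongrightarrow> \<Psi> (l 0) (l 1)"
    proof (rule main)
      show "continuous_on UNIV (case_prod \<Psi>)"
        unfolding \<Psi>_def case_prod_beta
        by (cases "i = 0"; cases "j = 0"; simp; intro continuous_intros)
      show "\<bar>\<Psi> u v\<bar> \<le> 1" if "0 \<le> u" "u \<le> 1" "0 \<le> v" "v \<le> 1" for u v
        using that by (auto simp: \<Psi>_def abs_mult intro!: mult_le_one)
    qed
    moreover have "\<Psi> (l 0) (l 1) = l i * l j"
      "\<Psi> (epsB p 0 X0 X1) (epsB p 1 X0 X1) = epsB p i X0 X1 * epsB p j X0 X1" for p X0 X1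
      using ij by (auto simp: \<Psi>_def less_2_cases_iff)
    ultimately show "(\<lambda>p. E_mu_S p (Sg p) (n p) (nu p) (m p) (\<lambda>mu0 mu1 X0 X1. epsB p i X0 X1 * epsB p j X0 X1))
      \<longlonglongrightarrow> Phi ((-1) ^ i * ((- H i + c) / sqrt F)) * Phi ((-1) ^ j * ((- H j + c) / sqrt F))"
      unfolding l_def[symmetric] by simp
  next
    have "(\<lambda>p. E_mu_S p (Sg p) (n p) (nu p) (m p)
        (\<lambda>mu0 mu1 X0 X1. (\<lambda>u v. (alpha 0 * u + alpha 1 * v) ^ 2) (epsB p 0 X0 X1) (epsB p 1 X0 X1)))
      \<longlonglongrightarrow> (alpha 0 * l 0 + alpha 1 * l 1) ^ 2"
    proof (rule main)
      show "continuous_on UNIV (\<lambda>(u, v). (alpha 0 * u + alpha 1 * v) ^ 2)"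
        unfolding case_prod_beta by (intro continuous_intros)
      fix u v :: real assume uv: "0 \<le> u" "u \<le> 1" "0 \<le> v" "v \<le> 1"
      have "0 \<le> alpha0 * u + (1 - alpha0) * v" "alpha0 * u + (1 - alpha0) * v \<le> 1"
        using uv alpha0 convex_bound_le[of u 1 v alpha0 "1 - alpha0"] by simp_all
      then show "\<bar>(alpha 0 * u + alpha 1 * v)\<^sup>2\<bar> \<le> 1"
        by (simp add: alpha_def power_le_one)
    qed
    then show "(\<lambda>p. E_mu_S p (Sg p) (n p) (nu p) (m p)
        (\<lambda>mu0 mu1 X0 X1. (alpha 0 * epsB p 0 X0 X1 + alpha 1 * epsB p 1 X0 X1) ^ 2))
      \<longlonglongrightarrow> (alpha0 * Phi ((- H 0 + c) / sqrt F) + (1 - alpha0) * Phi ((H 1 - c) / sqrt F)) ^ 2"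
      by (simp add: l_def alpha_def minus_divide_left)
  qed
qed

end
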